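(* For every $r\ge 1$ and integer $m\ge 2$, writing $h_k=h_k(q_1,\ldots,q_r)$ for the complete homogeneous symmetric polynomials (with $h_0=1$ and $h_{11}=h_1^2$), the Hilbert series of the spaces of diagonally harmonic polynomials in $r$ sets of variables satisfy: (1) for the cyclic group $\mathcal{C}_m=G(m,1,1)$: $\mathcal{H}_{\mathcal{C}_m}^{(r)}(\mathbf{q})=\sum_{j=0}^{m-1} h_j$; (2) for the dihedral group $I_2(m)=G(m,m,2)$: $\mathcal{H}_{I_2(m)}^{(r)}(\mathbf{q})=1+2h_1+h_{11}+h_2+2\sum_{j=3}^{m-1}h_j+h_m$; (3) for $G(m,1,2)$: $\mathcal{H}_{G(m,1,2)}^{(r)}(\mathbf{q})=\Big(\sum_{k=0}^{m-1}h_k\Big)^2+\sum_{k=0}^{m-1}(k+1)\,h_{m+k}+\sum_{k=1}^{m-1}(m-k)\,h_{2m-1+k}$.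
   Context: $G(m,p,n)$ (with $p\mid m$) denotes the group of $n\times n$ monomial matrices whose nonzero entries are $m$-th roots of unity and whose product of nonzero entries is an $(m/p)$-th root of unity. For such $W$ of rank $n$, let $X=(x_{ij})$ be an $r\times n$ matrix of variables, $\mathbb{C}[X]$ the polynomial ring with $W$ acting by $f(X)\mapsto f(Xw)$, $\mathcal{I}^{(r)}$ the ideal generated by $W$-invariants with zero constant term, and $\mathcal{H}_W^{(r)}$ the space of $g\in\mathbb{C}[X]$ with $f(\partial X)g=0$ for all $f\in\mathcal{I}^{(r)}$ (where $f(\partial X)$ substitutes $\partial/\partial x_{ij}$ for $x_{ij}$). With the $\mathbb{N}^r$-grading $\deg\prod x_{ij}^{a_{ij}}=(\sum_j a_{1j},\ldots,\sum_j a_{rj})$, the Hilbert series is $\mathcal{H}_W^{(r)}(\mathbf q)=\sum_{\mathbf d\in\mathbb{N}^r}\dim(\mathcal{H}_W^{(r)})_{\mathbf d}\,q_1^{d_1}\cdots q_r^{d_r}$.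
   Formalization: In (2) with m=2 the printed formula (empty sum read as 0) is false; the sum from j=3 to m-1 is read there as -h_2, so the series for I_2(2)=G(2,2,2) is 1+2h_1+h_{11}. For m≥3 the formula is as printed. *)

theory Defs
  imports "HOL-Analysis.Analysis" "HOL-Library.Poly_Mapping"
begin

text \<open>
  Polynomials with coefficients in \<open>'c\<close> and variables indexed by \<open>'v\<close> are finitely supported
  maps from exponent vectors to coefficients, with the convolution product of
  \<^theory>\<open>HOL-Library.Poly_Mapping\<close>. The entries of the \<open>r \<times> n\<close> matrix \<open>X\<close> of variables
  are indexed by \<open>'r \<times> 'n\<close>, where \<open>r = CARD('r)\<close> and \<open>n = CARD('n)\<close>.
\<close>

type_synonym ('v, 'c) mpol = "('v \<Rightarrow>\<^sub>0 nat) \<Rightarrow>\<^sub>0 'c"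

type_synonym ('r, 'n) polX = "('r \<times> 'n, complex) mpol"

definition pconst :: "'c::zero \<Rightarrow> ('v, 'c) mpol" where
  "pconst c = Poly_Mapping.single 0 c"

definition pvar :: "'v \<Rightarrow> ('v, 'c::zero_neq_one) mpol" where
  "pvar v = Poly_Mapping.single (Poly_Mapping.single v 1) 1"

definition pscale :: "'c::semiring_0 \<Rightarrow> ('v, 'c) mpol \<Rightarrow> ('v, 'c) mpol" where
  "pscale c f = pconst c * f"

definition psubst :: "('v \<Rightarrow> ('u, 'c) mpol) \<Rightarrow> ('v, 'c::comm_semiring_1) mpol \<Rightarrow> ('u, 'c) mpol" where
  "psubst \<phi> f =
    (\<Sum>a\<in>Poly_Mapping.keys f.
       pscale (Poly_Mapping.lookup f a) (\<Prod>v\<in>Poly_Mapping.keys a. \<phi> v ^ Poly_Mapping.lookup a v))"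

text \<open>
  The truncated subtraction of exponents is harmless: its coefficient vanishes if \<open>v\<close>
  does not occur in the monomial.
\<close>

definition pderivative :: "'v \<Rightarrow> ('v, 'c::comm_semiring_1) mpol \<Rightarrow> ('v, 'c) mpol" where
  "pderivative v f =
    (\<Sum>a\<in>Poly_Mapping.keys f.
       Poly_Mapping.single (a - Poly_Mapping.single v 1)
         (of_nat (Poly_Mapping.lookup a v) * Poly_Mapping.lookup f a))"

text \<open>
  The operator \<open>\<partial>\<^sup>a = \<Prod>\<^sub>v (\<partial>/\<partial>x\<^sub>v)\<^bsup>a(v)\<^esup>\<close>; the fold is independent of the order of
  the variables by \<open>comp_fun_commute_pderivative\<close> below.
\<close>

definition pderivs :: "('v \<Rightarrow>\<^sub>0 nat) \<Rightarrow> ('v, 'c::comm_semiring_1) mpol \<Rightarrow> ('v, 'c) mpol" where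
  "pderivs a g =
    Finite_Set.fold (\<lambda>v. pderivative v ^^ Poly_Mapping.lookup a v) g (Poly_Mapping.keys a)"

text \<open>\<open>apply_diff f g\<close> is \<open>f(\<partial>X) g\<close>.\<close>

definition apply_diff :: "('v, 'c::comm_semiring_1) mpol \<Rightarrow> ('v, 'c) mpol \<Rightarrow> ('v, 'c) mpol" where
  "apply_diff f g =
    (\<Sum>a\<in>Poly_Mapping.keys f. pscale (Poly_Mapping.lookup f a) (pderivs a g))"

lemma lookup_pderivative:
  "Poly_Mapping.lookup (pderivative v f) b =
    of_nat (Suc (Poly_Mapping.lookup b v)) * Poly_Mapping.lookup f (b + Poly_Mapping.single v 1)"
proof -
  let ?s = "Poly_Mapping.single v (1::nat)"
  have eq: "(if a - ?s = b then of_nat (Poly_Mapping.lookup a v) * Poly_Mapping.lookup f a else 0) =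
      (if a = b + ?s then of_nat (Suc (Poly_Mapping.lookup b v)) * Poly_Mapping.lookup f (b + ?s) else 0)" for a
  proof (cases "Poly_Mapping.lookup a v = 0")
    case True
    then have "a \<noteq> b + ?s"
      by (auto simp: lookup_add)
    with True show ?thesis by simp
  next
    case False
    then have "a - ?s + ?s = a"
      by (intro poly_mapping_eqI) (auto simp: lookup_add lookup_minus lookup_single when_def)
    then have "a - ?s = b \<longleftrightarrow> a = b + ?s" by auto
    then show ?thesis by (auto simp: lookup_add)
  qed
  have "Poly_Mapping.lookup (pderivative v f) b =
      (\<Sum>a\<in>Poly_Mapping.keys f. if a - ?s = b then of_nat (Poly_Mapping.lookup a v) * Poly_Mapping.lookup f a else 0)"
    by (simp add: pderivative_def lookup_sum lookup_single when_def)
  also have "\<dots> = of_nat (Suc (Poly_Mapping.lookup b v)) * Poly_Mapping.lookup f (b + ?s)"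
    unfolding eq by (simp add: in_keys_iff del: of_nat_Suc)
  finally show ?thesis .
qed

lemma pderivative_commute: "pderivative v (pderivative w f) = pderivative w (pderivative v f)"
proof (cases "v = w")
  case False
  show ?thesis
  proof (rule poly_mapping_eqI)
    fix b
    have "b + Poly_Mapping.single v 1 + Poly_Mapping.single w 1 =
        b + Poly_Mapping.single w 1 + Poly_Mapping.single v (1::nat)"
      by (simp only: ac_simps)
    with False show "Poly_Mapping.lookup (pderivative v (pderivative w f)) b =
        Poly_Mapping.lookup (pderivative w (pderivative v f)) b"
      by (simp add: lookup_pderivative lookup_add lookup_single mult.left_commute del: of_nat_Suc)
  qed
qed simp

lemma comp_fun_commute_pderivative:
  fixes a :: "'v \<Rightarrow>\<^sub>0 nat"
  shows "comp_fun_commute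
    (\<lambda>v. pderivative v ^^ Poly_Mapping.lookup a v :: ('v, 'c::comm_semiring_1) mpol \<Rightarrow> _)"
proof
  fix v w
  have 1: "pderivative w ((pderivative v ^^ k) f) = (pderivative v ^^ k) (pderivative w f)"
    for k and f :: "('v, 'c) mpol"
    by (induction k) (simp_all add: pderivative_commute[of w v])
  have "(pderivative w ^^ l) ((pderivative v ^^ k) f) = (pderivative v ^^ k) ((pderivative w ^^ l) f)"
    for k l and f :: "('v, 'c) mpol"
    by (induction l) (simp_all add: 1)
  then show "(pderivative w ^^ Poly_Mapping.lookup a w) \<circ> (pderivative v ^^ Poly_Mapping.lookup a v) =
      (pderivative v ^^ Poly_Mapping.lookup a v) \<circ>
      (pderivative w ^^ Poly_Mapping.lookup a w :: ('v, 'c) mpol \<Rightarrow> _)"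
    by (simp add: fun_eq_iff)
qed

lemma vector_space_pscale: "vector_space (pscale :: complex \<Rightarrow> ('v, complex) mpol \<Rightarrow> _)"
proof
  show "pscale a (pscale b f) = pscale (a * b) f" for a b and f :: "('v, complex) mpol"
    by (simp only: pscale_def pconst_def mult.assoc[symmetric] mult_single) simp
qed (simp_all add: pscale_def pconst_def distrib_left distrib_right single_add)

text \<open>The group \<open>G(m,p,n)\<close>, for \<open>p\<close> dividing \<open>m\<close>.\<close>

definition monomial_matrix :: "complex ^ 'n ^ 'n \<Rightarrow> bool" where
  "monomial_matrix w \<longleftrightarrow> (\<forall>i. \<exists>!j. w $ i $ j \<noteq> 0) \<and> (\<forall>j. \<exists>!i. w $ i $ j \<noteq> 0)"

definition G :: "nat \<Rightarrow> nat \<Rightarrow> (complex ^ 'n::finite ^ 'n) set" where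
  "G m p = {w. monomial_matrix w \<and>
               (\<forall>i j. w $ i $ j \<noteq> 0 \<longrightarrow> (w $ i $ j) ^ m = 1) \<and>
               (\<Prod>(i, j)\<in>{(i, j). w $ i $ j \<noteq> 0}. w $ i $ j) ^ (m div p) = 1}"

text \<open>\<open>act w f\<close> is \<open>f(Xw)\<close>.\<close>

definition act :: "complex ^ 'n::finite ^ 'n \<Rightarrow> ('r, 'n) polX \<Rightarrow> ('r, 'n) polX" where
  "act w f = psubst (\<lambda>(i, j). \<Sum>k\<in>UNIV. pscale (w $ k $ j) (pvar (i, k))) f"

definition invariants :: "(complex ^ 'n::finite ^ 'n) set \<Rightarrow> ('r, 'n) polX set" where
  "invariants W = {f. \<forall>w\<in>W. act w f = f}"

text \<open>Spans for the module structure of a ring over itself are generated ideals.\<close>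

definition inv_ideal :: "(complex ^ 'n::finite ^ 'n) set \<Rightarrow> ('r, 'n) polX set" where
  "inv_ideal W = module.span (*) {f \<in> invariants W. Poly_Mapping.lookup f 0 = 0}"

definition harmonics :: "(complex ^ 'n::finite ^ 'n) set \<Rightarrow> ('r, 'n) polX set" where
  "harmonics W = {g. \<forall>f\<in>inv_ideal W. apply_diff f g = 0}"

definition homog_part :: "('r \<Rightarrow>\<^sub>0 nat) \<Rightarrow> ('r, 'n::finite) polX set" where
  "homog_part d =
    {g. \<forall>a\<in>Poly_Mapping.keys g. \<forall>i. (\<Sum>j\<in>UNIV. Poly_Mapping.lookup a (i, j)) = Poly_Mapping.lookup d i}"

text \<open>
  A formal power series in \<open>\<^bold>q = (q\<^sub>i)\<close>, \<open>i\<close> ranging over the finite type \<open>'r\<close>, is represented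
  by its coefficient function on exponent vectors; a polynomial \<open>P\<close> in \<open>\<^bold>q\<close>, of type
  \<open>('r, int) mpol\<close>, is the power series \<open>Poly_Mapping.lookup P\<close>.
\<close>

definition hilbert_series ::
    "(complex ^ 'n::finite ^ 'n) set \<Rightarrow> ('r::finite \<Rightarrow>\<^sub>0 nat) \<Rightarrow> int" where
  "hilbert_series W d =
    int (vector_space.dim pscale (harmonics W \<inter> (homog_part d :: ('r, 'n) polX set)))"

definition h :: "nat \<Rightarrow> ('r::finite, int) mpol" where
  "h k = (\<Sum>d | (\<Sum>i\<in>UNIV. Poly_Mapping.lookup d i) = k. Poly_Mapping.single d 1)"

lemma finite_exponents_degree:
  "finite {d :: 'r::finite \<Rightarrow>\<^sub>0 nat. (\<Sum>i\<in>UNIV. Poly_Mapping.lookup d i) = k}"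
proof (rule finite_imageD)
  show "inj_on Poly_Mapping.lookup {d :: 'r \<Rightarrow>\<^sub>0 nat. (\<Sum>i\<in>UNIV. Poly_Mapping.lookup d i) = k}"
    by (simp add: inj_on_def)
  have "Poly_Mapping.lookup d i \<le> (\<Sum>i\<in>UNIV. Poly_Mapping.lookup d i)" for d :: "'r \<Rightarrow>\<^sub>0 nat" and i
    by (rule member_le_sum) auto
  then have "Poly_Mapping.lookup ` {d :: 'r \<Rightarrow>\<^sub>0 nat. (\<Sum>i\<in>UNIV. Poly_Mapping.lookup d i) = k} \<subseteq>
      (\<Pi>\<^sub>E i\<in>UNIV. {..k})"
    by (auto simp: PiE_def)
  then show "finite (Poly_Mapping.lookup ` {d :: 'r \<Rightarrow>\<^sub>0 nat. (\<Sum>i\<in>UNIV. Poly_Mapping.lookup d i) = k})"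
    by (rule finite_subset) (simp add: finite_PiE)
qed

lemma lookup_h:
  "Poly_Mapping.lookup (h k) d = of_bool ((\<Sum>i\<in>UNIV. Poly_Mapping.lookup d i) = k)"
  by (simp add: h_def lookup_sum lookup_single when_def finite_exponents_degree)

lemma h_0: "h 0 = (1 :: ('r::finite, int) mpol)"
proof (rule poly_mapping_eqI)
  fix d :: "'r \<Rightarrow>\<^sub>0 nat"
  have "(\<Sum>i\<in>UNIV. Poly_Mapping.lookup d i) = 0 \<longleftrightarrow> d = 0"
    by (auto intro: poly_mapping_eqI)
  then show "Poly_Mapping.lookup (h 0) d = Poly_Mapping.lookup (1 :: ('r, int) mpol) d"
    by (simp add: lookup_h lookup_one when_def)
qed

text \<open>
  The sum from \<open>a\<close> to \<open>b\<close>, with the usual extension \<open>\<Sum>\<^bsub>j=a\<^esub>\<^bsup>b\<^esup> f(j) = -\<Sum>\<^bsub>j=b+1\<^esub>\<^bsup>a-1\<^esup> f(j)\<close>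
  to \<open>b < a\<close> (Karr's convention), which for \<open>b = a - 1\<close> is the empty sum. It matters for
  the dihedral groups: in the sum from \<open>3\<close> to \<open>m - 1\<close> the case \<open>m = 2\<close> contributes \<open>-h\<^sub>2\<close>, and
  the formula becomes \<open>1 + 2h\<^sub>1 + h\<^sub>1\<^sub>1\<close>, the Hilbert series for \<open>G(2,2,2)\<close>. For
  \<open>m \<ge> 3\<close> it is the plain sum.
\<close>

definition sum_from_to :: "nat \<Rightarrow> nat \<Rightarrow> (nat \<Rightarrow> 'a::ab_group_add) \<Rightarrow> 'a" where
  "sum_from_to a b f = (if a \<le> b then \<Sum>j=a..b. f j else - (\<Sum>j=b+1..<a. f j))"

end

theory Submission
  imports Defs
begin

text \<open>
  Rescale the coefficient of \<open>X\<^sup>a\<close> in \<open>g\<close> by \<open>a!\<close>. Then \<open>\<partial>\<^sup>b\<close> becomes the index shift \<open>a \<mapsto> a + b\<close>, and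
  \<open>g\<close> is harmonic iff its rescaled coefficients \<open>c\<close> are orthogonal to all monomial multiples of the
  invariants. In rank two, with \<open>c(u, v)\<close> the coefficient of \<open>x\<^sup>u y\<^sup>v\<close> (\<open>x\<close>, \<open>y\<close> the two columns of
  \<open>X\<close>), this says \<open>c(a + u, b + v) + c(b + u, a + v) = 0\<close> whenever \<open>x\<^sup>a y\<^sup>b\<close> is a non-constant monomial
  fixed by the diagonal matrices of the group. In a fixed multidegree these relations make \<open>c\<close>
  vanish on some monomials and determine it up to one scalar on each of several disjoint classes of the
  others, so the dimension is the number of classes.

  For \<open>G(m,m,2)\<close> the classes are the pure monomials of degree below \<open>m\<close>, the pairs
  \<open>{x\<^sup>d, y\<^sup>d}\<close> of degree \<open>m\<close>, and the pairs \<open>{x\<^sub>i y\<^sub>j, x\<^sub>j y\<^sub>i}\<close> with \<open>i \<noteq> j\<close>. For \<open>G(m,1,2)\<close> they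
  are the single monomials \<open>x\<^sup>u y\<^sup>v\<close> with \<open>|u|, |v| < m\<close> and, for all \<open>k, j < m\<close>, the monomials of
  bidegree \<open>(m + k, j)\<close> or \<open>(k, m + j)\<close>, on which \<open>c\<close> is constant up to sign: moving a degree-\<open>m\<close>
  factor from one column to the other and back exchanges arbitrary factors.
\<close>

abbreviation "lookup \<equiv> Poly_Mapping.lookup"
abbreviation "single \<equiv> Poly_Mapping.single"
abbreviation "keys \<equiv> Poly_Mapping.keys"

interpretation mpol: vector_space "pscale :: complex \<Rightarrow> ('v, complex) mpol \<Rightarrow> ('v, complex) mpol"
  by (rule vector_space_pscale)

subsection \<open>Harmonics in terms of rescaled coefficients\<close>

lemma lookup_pscale: "lookup (pscale c f) a = c * lookup f a"
proof -
  have "lookup (pscale c f) a = lookup (Poly_Mapping.map ((*) c) f) a"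
    by (simp add: pscale_def pconst_def mult_map_scale_conv_mult)
  also have "\<dots> = c * lookup f a"
    by (simp add: map.rep_eq when_def)
  finally show ?thesis .
qed

lemma sum_single_keys: "(\<Sum>b\<in>keys f. single b (lookup f b)) = f"
  by (rule poly_mapping_eqI) (auto simp: lookup_sum lookup_single when_def in_keys_iff)

lemma single_times:
  fixes f :: "('v, 'c::comm_semiring_1) mpol"
  shows "single a k * f = (\<Sum>b\<in>keys f. single (a + b) (k * lookup f b))"
proof -
  have "single a k * (\<Sum>b\<in>keys f. single b (lookup f b)) =
      (\<Sum>b\<in>keys f. single (a + b) (k * lookup f b))"
    by (simp add: sum_distrib_left mult_single)
  then show ?thesis by (simp only: sum_single_keys)
qed

text \<open>\<open>dcoeff g a\<close> is the constant term of the iterated derivative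
  \<open>pderivs a g\<close>.\<close>

definition dcoeff :: "('v::finite, complex) mpol \<Rightarrow> ('v \<Rightarrow>\<^sub>0 nat) \<Rightarrow> complex" where
  "dcoeff g a = (\<Prod>v\<in>UNIV. fact (lookup a v)) * lookup g a"

lemma dcoeff_eq_0_iff: "dcoeff g a = 0 \<longleftrightarrow> lookup g a = 0"
  by (simp add: dcoeff_def)

lemma dcoeff_zero [simp]: "dcoeff 0 a = 0"
  by (simp add: dcoeff_def)

lemma dcoeff_eq_0D: "(\<And>a. dcoeff g a = 0) \<Longrightarrow> g = 0"
  by (intro poly_mapping_eqI) (simp add: dcoeff_eq_0_iff)

lemma dcoeff_pscale: "dcoeff (pscale c g) a = c * dcoeff g a"
  by (simp add: dcoeff_def lookup_pscale)

lemma dcoeff_add: "dcoeff (f + g) a = dcoeff f a + dcoeff g a"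
  by (simp add: dcoeff_def lookup_add distrib_left)

lemma dcoeff_sum: "dcoeff (\<Sum>x\<in>A. g x) a = (\<Sum>x\<in>A. dcoeff (g x) a)"
  by (simp add: dcoeff_def lookup_sum sum_distrib_left)

lemma dcoeff_pderivative: "dcoeff (pderivative v g) b = dcoeff g (b + single v 1)"
proof -
  have eq: "(\<Prod>u\<in>UNIV - {v}. fact (lookup (b + single v 1) u) :: complex) =
      (\<Prod>u\<in>UNIV - {v}. fact (lookup b u))"
    by (rule prod.cong) (auto simp: lookup_add lookup_single when_def)
  have "(\<Prod>u\<in>UNIV. fact (lookup (b + single v 1) u) :: complex) =
      of_nat (Suc (lookup b v)) * (\<Prod>u\<in>UNIV. fact (lookup b u))"
    unfolding prod.remove[OF finite UNIV_I, of _ v] eq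
    by (simp add: lookup_add algebra_simps)
  then show ?thesis
    unfolding dcoeff_def lookup_pderivative by (simp only: ac_simps)
qed

lemma dcoeff_pderivs: "dcoeff (pderivs a g) b = dcoeff g (a + b)"
proof -
  interpret comp_fun_commute
    "\<lambda>v. pderivative v ^^ lookup a v :: ('a, complex) mpol \<Rightarrow> ('a, complex) mpol"
    by (rule comp_fun_commute_pderivative)
  have pow: "dcoeff ((pderivative v ^^ k) f) b = dcoeff f (b + single v k)" for v k f b
  proof (induction k arbitrary: b)
    case (Suc k)
    have "b + single v 1 + single v k = b + single v (Suc k)"
      by (simp add: add.assoc flip: single_add)
    with Suc show ?case by (simp add: dcoeff_pderivative)
  qed simp
  \<comment> \<open>The fold is generalised from \<open>keys a\<close> to any finite
    \<open>S\<close>; for \<open>S = keys a\<close> the accumulated shift is \<open>a\<close> by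
    \<open>sum_single_keys\<close>.\<close>
  have "dcoeff (Finite_Set.fold (\<lambda>v. pderivative v ^^ lookup a v) g S) b =
      dcoeff g (b + (\<Sum>v\<in>S. single v (lookup a v)))" if "finite S" for S
    using that by (induction S arbitrary: b) (simp_all add: pow add.assoc)
  then show ?thesis
    by (simp add: pderivs_def sum_single_keys add.commute)
qed

lemma dcoeff_apply_diff:
  "dcoeff (apply_diff f g) b = (\<Sum>a\<in>keys f. lookup f a * dcoeff g (a + b))"
  by (simp add: apply_diff_def dcoeff_sum dcoeff_pscale dcoeff_pderivs)

lemma apply_diff_eq_0_iff:
  "apply_diff f g = 0 \<longleftrightarrow> (\<forall>b. (\<Sum>a\<in>keys f. lookup f a * dcoeff g (a + b)) = 0)"
proof -
  have "apply_diff f g = 0 \<longleftrightarrow> (\<forall>b. dcoeff (apply_diff f g) b = 0)"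
    by (auto intro: dcoeff_eq_0D)
  then show ?thesis by (simp only: dcoeff_apply_diff)
qed

lemma apply_diff_add: "apply_diff (f + f') g = apply_diff f g + apply_diff f' (g :: ('v, complex) mpol)"
  unfolding apply_diff_def
  by (rule setsum_keys_plus_distrib) (simp_all add: mpol.scale_left_distrib)

lemma apply_diff_sum:
  "apply_diff (\<Sum>x\<in>A. f x) g = (\<Sum>x\<in>A. apply_diff (f x) (g :: ('v, complex) mpol))"
  by (induction A rule: infinite_finite_induct) (simp_all add: apply_diff_add, simp_all add: apply_diff_def)

lemma dcoeff_apply_diff_single: "dcoeff (apply_diff (single a k) g) b = k * dcoeff g (a + b)"
  by (simp add: dcoeff_apply_diff)

text \<open>Multiplying \<open>f\<close> by a monomial translates the rescaled coefficients of
  \<open>apply_diff f g\<close> by \<open>a\<close> and scales them by \<open>k\<close>, so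
  vanishing is preserved.\<close>

lemma apply_diff_single_times_eq_0:
  fixes g :: "('v::finite, complex) mpol"
  assumes "apply_diff f g = 0"
  shows "apply_diff (single a k * f) g = 0"
proof -
  have "dcoeff (apply_diff (single a k * f) g) b = 0" for b
  proof -
    have "dcoeff (apply_diff (single a k * f) g) b =
        (\<Sum>x\<in>keys f. k * lookup f x * dcoeff g (a + x + b))"
      by (simp only: single_times apply_diff_sum dcoeff_sum dcoeff_apply_diff_single)
    also have "\<dots> = k * (\<Sum>x\<in>keys f. lookup f x * dcoeff g (x + (a + b)))"
      by (simp add: sum_distrib_left ac_simps)
    also have "\<dots> = 0"
      using assms by (simp add: apply_diff_eq_0_iff)
    finally show ?thesis .
  qed
  then show ?thesis by (rule dcoeff_eq_0D)
qed

lemma apply_diff_times_eq_0: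
  fixes g :: "('v::finite, complex) mpol"
  assumes "apply_diff f g = 0"
  shows "apply_diff (p * f) g = 0"
proof -
  have "apply_diff ((\<Sum>a\<in>keys p. single a (lookup p a)) * f) g = 0"
    using assms by (simp add: sum_distrib_right apply_diff_sum apply_diff_single_times_eq_0)
  then show ?thesis by (simp add: sum_single_keys)
qed

text \<open>The polynomials whose operator kills \<open>g\<close> form an ideal, so testing the
  generators of \<open>inv_ideal W\<close> is enough.\<close>

lemma harmonics_iff:
  fixes g :: "('r::finite, 'n::finite) polX"
  shows "g \<in> harmonics W \<longleftrightarrow> (\<forall>f\<in>invariants W. lookup f 0 = 0 \<longrightarrow> apply_diff f g = 0)"
proof -
  interpret ring: module "(*) :: ('r, 'n) polX \<Rightarrow> _"
    by unfold_locales (simp_all add: distrib_left distrib_right mult.assoc)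
  let ?S = "{f \<in> invariants W. lookup f 0 = 0} :: ('r, 'n) polX set"
  have "apply_diff f g = 0" if "\<forall>f\<in>?S. apply_diff f g = 0" "f \<in> inv_ideal W" for f
    using that(2) unfolding inv_ideal_def
    by (induction rule: ring.span_induct_alt)
      (use that(1) in \<open>simp_all add: apply_diff_add apply_diff_times_eq_0\<close>, simp add: apply_diff_def)
  moreover have "?S \<subseteq> inv_ideal W"
    unfolding inv_ideal_def by (rule ring.span_superset)
  ultimately show ?thesis
    unfolding harmonics_def by blast
qed

section \<open>Dimension as a number of classes\<close>

text \<open>A basis of \<open>V\<close> has one polynomial per class, with rescaled coefficients
  \<epsilon> on the class and zero elsewhere. The function \<epsilon> records the fixed ratios
  inside a class, which are signs in the applications; proportionality is cross-multiplied to avoid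
  division.\<close>

lemma dim_eq_card_classes:
  fixes P :: "'k \<Rightarrow> ('v::finite \<Rightarrow>\<^sub>0 nat) set" and \<epsilon> :: "('v \<Rightarrow>\<^sub>0 nat) \<Rightarrow> complex"
  assumes K: "finite K" and disj: "disjoint_family_on P K"
    and fin: "\<And>k. k \<in> K \<Longrightarrow> finite (P k)" and ne: "\<And>k. k \<in> K \<Longrightarrow> P k \<noteq> {}"
    and \<epsilon>: "\<And>p. \<epsilon> p \<noteq> 0"
    and V: "\<And>g. g \<in> V \<longleftrightarrow> (\<forall>p. p \<notin> (\<Union>k\<in>K. P k) \<longrightarrow> dcoeff g p = 0) \<and>
      (\<forall>k\<in>K. \<forall>p\<in>P k. \<forall>q\<in>P k. \<epsilon> q * dcoeff g p = \<epsilon> p * dcoeff g q)"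
  shows "mpol.dim V = card K"
proof -
  \<comment> \<open>\<open>w\<close> undoes the factorial rescaling, so that \<open>b k\<close> has
    \<open>dcoeff\<close> equal to \<epsilon> on \<open>P k\<close>.\<close>
  define w where "w p = \<epsilon> p / (\<Prod>v\<in>UNIV. fact (lookup p v))" for p
  define b where "b k = (\<Sum>p\<in>P k. single p (w p))" for k
  have w: "w p \<noteq> 0" for p using \<epsilon> by (simp add: w_def)
  have lookup_b: "lookup (b k) p = (if p \<in> P k then w p else 0)" if "k \<in> K" for k p
    using fin[OF that] by (simp add: b_def lookup_sum lookup_single when_def)
  have dcoeff_b: "dcoeff (b k) p = (if p \<in> P k then \<epsilon> p else 0)" if "k \<in> K" for k p
    using that by (simp add: dcoeff_def lookup_b w_def)
  have unique: "k = l" if "k \<in> K" "l \<in> K" "p \<in> P k" "p \<in> P l" for k l p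
    using disjoint_family_onD[OF disj] that by blast
  have inj: "inj_on b K"
  proof (rule inj_onI)
    fix k l assume kl: "k \<in> K" "l \<in> K" "b k = b l"
    obtain p where p: "p \<in> P k" using ne[OF kl(1)] by blast
    then have "lookup (b l) p \<noteq> 0" using kl w lookup_b[OF kl(1), of p] by simp
    then show "k = l" using lookup_b[OF kl(2), of p] unique p kl by (auto split: if_splits)
  qed
  have coeff_at: "lookup (\<Sum>l\<in>K. pscale (t l) (b l)) p = t k * w p" if "k \<in> K" "p \<in> P k" for t k p
  proof -
    have "lookup (\<Sum>l\<in>K. pscale (t l) (b l)) p = (\<Sum>l\<in>K. if l = k then t k * w p else 0)"
      unfolding lookup_sum lookup_pscale
      by (rule sum.cong) (use that unique in \<open>auto simp: lookup_b\<close>)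
    then show ?thesis using that K by simp
  qed
  have "mpol.independent (b ` K)"
  proof (rule mpol.independent_if_scalars_zero)
    fix t x assume *: "(\<Sum>x\<in>b ` K. pscale (t x) x) = 0" and "x \<in> b ` K"
    then obtain k where k: "k \<in> K" "x = b k" by blast
    obtain p where p: "p \<in> P k" using ne[OF k(1)] by blast
    have "lookup (\<Sum>l\<in>K. pscale (t (b l)) (b l)) p = 0"
      using * by (simp add: sum.reindex[OF inj])
    then show "t x = 0" using coeff_at[OF k(1) p, of "\<lambda>l. t (b l)"] w k by simp
  qed (use K in simp)
  moreover have "b ` K \<subseteq> V"
  proof safe
    fix k assume k: "k \<in> K"
    show "b k \<in> V"
      unfolding V using k unique by (auto simp: dcoeff_b)
  qed
  moreover have "V \<subseteq> mpol.span (b ` K)"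
  proof
    fix g assume g: "g \<in> V"
    \<comment> \<open>The coordinate of \<open>g\<close> along \<open>b k\<close> is read off at one
      chosen member of \<open>P k\<close>; proportionality makes the choice immaterial.\<close>
    define t where "t k = (let p = SOME p. p \<in> P k in lookup g p / w p)" for k
    have t: "lookup g p = t k * w p" if "k \<in> K" "p \<in> P k" for k p
    proof -
      define q where "q = (SOME q. q \<in> P k)"
      have q: "q \<in> P k" unfolding q_def using that by (rule_tac someI)
      have "\<epsilon> q * dcoeff g p = \<epsilon> p * dcoeff g q" using g that q unfolding V by blast
      moreover have "dcoeff g q = \<epsilon> q * t k"
        using \<epsilon>[of q] by (simp add: t_def w_def dcoeff_def flip: q_def)
      ultimately have "\<epsilon> q * dcoeff g p = \<epsilon> q * (\<epsilon> p * t k)"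
        by (simp only: ac_simps)
      then have "dcoeff g p = \<epsilon> p * t k"
        using \<epsilon>[of q] by simp
      then show ?thesis
        by (simp add: w_def dcoeff_def field_simps)
    qed
    have "g = (\<Sum>k\<in>K. pscale (t k) (b k))"
    proof (rule poly_mapping_eqI)
      fix p
      show "lookup g p = lookup (\<Sum>k\<in>K. pscale (t k) (b k)) p"
      proof (cases "\<exists>k\<in>K. p \<in> P k")
        case True
        then show ?thesis using t coeff_at by metis
      next
        case False
        then have "lookup g p = 0" using g unfolding V by (auto simp: dcoeff_eq_0_iff)
        then show ?thesis using False by (simp add: lookup_sum lookup_pscale lookup_b)
      qed
    qed
    also have "\<dots> \<in> mpol.span (b ` K)"
      by (intro mpol.span_sum mpol.span_scale mpol.span_base imageI)
    finally show "g \<in> mpol.span (b ` K)" .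
  qed
  ultimately show ?thesis
    using mpol.dim_unique[of "b ` K" V] card_image[OF inj] by simp
qed

subsection \<open>Degrees of exponent vectors\<close>

definition deg :: "('v::finite \<Rightarrow>\<^sub>0 nat) \<Rightarrow> nat" where
  "deg u = (\<Sum>i\<in>UNIV. lookup u i)"

lemma deg_zero [simp]: "deg 0 = 0"
  by (simp add: deg_def)

lemma deg_add [simp]: "deg (u + v) = deg u + deg v"
  by (simp add: deg_def lookup_add sum.distrib)

lemma deg_single [simp]: "deg (single i k) = k"
  by (simp add: deg_def lookup_single when_def)

lemma deg_eq_0_iff [simp]: "deg u = 0 \<longleftrightarrow> u = 0"
  by (auto simp: deg_def intro: poly_mapping_eqI)

lemma deg_pos_iff [simp]: "0 < deg u \<longleftrightarrow> u \<noteq> 0"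
  using deg_eq_0_iff[of u] by linarith

lemma finite_deg_eq: "finite {u :: 'v::finite \<Rightarrow>\<^sub>0 nat. deg u = k}"
  unfolding deg_def by (rule finite_exponents_degree)

lemma lookup_h_deg: "lookup (h k) d = of_bool (deg d = k)"
  unfolding deg_def by (rule lookup_h)

text \<open>Variables are peeled off one at a time. This extracts a factor of prescribed degree from
  a monomial, as for the degrees \<open>1\<close>, \<open>m - 1\<close> and \<open>m\<close> later
  on.\<close>

lemma deg_split: "k \<le> deg u \<Longrightarrow> \<exists>a w. u = a + w \<and> deg a = k"
proof (induction k)
  case 0
  show ?case by (rule exI[of _ 0]) simp
next
  case (Suc k)
  then obtain a w where aw: "u = a + w" "deg a = k" by auto
  with Suc.prems have "w \<noteq> 0" by auto
  then obtain i where i: "lookup w i \<noteq> 0" by (metis lookup_zero poly_mapping_eqI)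
  then have "single i 1 + (w - single i 1) = w"
    by (intro poly_mapping_eqI) (auto simp: lookup_add lookup_minus lookup_single when_def)
  then have "u = (a + single i 1) + (w - single i 1)"
    by (simp only: aw(1) add.assoc)
  moreover have "deg (a + single i 1) = Suc k"
    using aw(2) by simp
  ultimately show ?case by blast
qed

lemma finite_add_decomps: "finite {(u, v). u + v = (d :: 'v::finite \<Rightarrow>\<^sub>0 nat)}"
proof (rule finite_subset)
  show "{(u, v). u + v = d} \<subseteq> (\<Union>k\<le>deg d. {u. deg u = k}) \<times> (\<Union>k\<le>deg d. {u. deg u = k})"
    by auto
  show "finite ((\<Union>k\<le>deg d. {u :: 'v \<Rightarrow>\<^sub>0 nat. deg u = k}) \<times> (\<Union>k\<le>deg d. {u :: 'v \<Rightarrow>\<^sub>0 nat. deg u = k}))"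
    by (intro finite_cartesian_product finite_UN_I finite_deg_eq finite_atMost)
qed

text \<open>Every monomial of degree \<open>k\<close> has coefficient one in \<open>h k\<close>, so
  the product counts factorizations into monomials of the two degrees.\<close>

lemma lookup_h_times_h:
  fixes d :: "'r::finite \<Rightarrow>\<^sub>0 nat"
  shows "lookup (h k * h l) d = int (card {(u, v). u + v = d \<and> deg u = k \<and> deg v = l})"
proof -
  have "(h k * h l :: ('r, int) mpol) = (\<Sum>u | deg u = k. \<Sum>v | deg v = l. single (u + v) (1::int))"
    by (simp add: h_def deg_def sum_product mult_single)
  also have "\<dots> = (\<Sum>(u, v)\<in>{u. deg u = k} \<times> {v. deg v = l}. single (u + v) 1)"
    by (simp add: sum.cartesian_product)
  finally have "lookup (h k * h l) d =
      (\<Sum>(u, v)\<in>{u. deg u = k} \<times> {v. deg v = l}. of_bool (u + v = d))"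
    by (simp add: lookup_sum case_prod_beta lookup_single when_def of_bool_def eq_commute[of d])
  also have "\<dots> = (\<Sum>x\<in>{u. deg u = k} \<times> {v. deg v = l}. if fst x + snd x = d then 1 else 0)"
    by (rule sum.cong) auto
  also have "\<dots> = int (card {x \<in> {u. deg u = k} \<times> {v. deg v = l}. fst x + snd x = d})"
    by (simp add: sum.If_cases finite_cartesian_product finite_deg_eq Int_def)
  also have "{x \<in> {u. deg u = k} \<times> {v. deg v = l}. fst x + snd x = d} =
      {(u, v). u + v = d \<and> deg u = k \<and> deg v = l}"
    by auto
  finally show ?thesis .
qed

subsection \<open>Action of monomial matrices\<close>

text \<open>The substitution sends each monomial to a multiple of a single monomial, and distinct
  exponents to distinct ones because \<tau> is bijective. Hence only one term of \<open>f\<close>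
  contributes to the coefficient at \<open>b\<close>.\<close>

lemma lookup_psubst_monomial:
  fixes f :: "('v::finite, 'c::comm_ring_1) mpol" and \<tau> :: "'v \<Rightarrow> 'v"
  assumes \<tau>: "bij \<tau>"
  shows "lookup (psubst (\<lambda>v. pscale (c v) (pvar (\<tau> v))) f) b =
    lookup f (Poly_Mapping.map_key \<tau> b) * (\<Prod>v\<in>UNIV. c v ^ lookup b (\<tau> v))"
proof -
  have inj: "inj \<tau>" using \<tau> by (rule bij_is_inj)
  \<comment> \<open>\<open>e a\<close> is the exponent of the image of the monomial with exponent
    \<open>a\<close>.\<close>
  define e where "e a = (\<Sum>v\<in>keys a. single (\<tau> v) (lookup a v))" for a :: "'v \<Rightarrow>\<^sub>0 nat"
  have e: "lookup (e a) (\<tau> u) = lookup a u" for a u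
    using inj by (simp add: e_def lookup_sum lookup_single when_def inj_eq in_keys_iff)
  have e_eq: "e a = b \<longleftrightarrow> a = Poly_Mapping.map_key \<tau> b" for a b
  proof -
    have "e a = b \<longleftrightarrow> (\<forall>u. lookup (e a) (\<tau> u) = lookup b (\<tau> u))"
      using \<tau> by (metis bij_pointE poly_mapping_eqI)
    also have "\<dots> \<longleftrightarrow> a = Poly_Mapping.map_key \<tau> b"
      by (auto simp: e map_key.rep_eq[OF inj] poly_mapping_eq_iff fun_eq_iff)
    finally show ?thesis .
  qed
  have pow: "pscale x (pvar v) ^ n = single (single v n) (x ^ n)" for x :: 'c and v :: 'v and n
    by (induction n) (simp_all add: pscale_def pconst_def pvar_def mult_single flip: single_add)
  have mono: "(\<Prod>v\<in>S. pscale (c v) (pvar (\<tau> v)) ^ n v) =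
      single (\<Sum>v\<in>S. single (\<tau> v) (n v)) (\<Prod>v\<in>S. c v ^ n v)" if "finite S" for S n
    using that by induction (simp_all add: pow mult_single)
  have prod: "(\<Prod>v\<in>keys a. c v ^ lookup a v) = (\<Prod>v\<in>UNIV. c v ^ lookup a v)" for a
    by (rule prod.mono_neutral_left) (auto simp: in_keys_iff)
  have "psubst (\<lambda>v. pscale (c v) (pvar (\<tau> v))) f =
      (\<Sum>a\<in>keys f. single (e a) (lookup f a * (\<Prod>v\<in>UNIV. c v ^ lookup a v)))"
    unfolding psubst_def mono[OF finite_keys] prod e_def[symmetric]
    by (simp add: pscale_def pconst_def mult_single)
  then have "lookup (psubst (\<lambda>v. pscale (c v) (pvar (\<tau> v))) f) b =
      (\<Sum>a\<in>keys f. if a = Poly_Mapping.map_key \<tau> b then lookup f a * (\<Prod>v\<in>UNIV. c v ^ lookup a v) else 0)"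
    by (simp add: lookup_sum lookup_single when_def e_eq)
  then show ?thesis
    by (simp add: in_keys_iff map_key.rep_eq[OF inj])
qed

text \<open>Only the entry in row \<open>\<sigma> j\<close> of column \<open>j\<close> can be
  nonzero, so \<open>act w\<close> replaces each variable in column \<open>j\<close> by a multiple
  of the one in column \<open>\<sigma> j\<close> of the same row. All rows of \<open>X\<close> move
  alike, whence \<open>map_prod id \<sigma>\<close>.\<close>

lemma lookup_act:
  fixes f :: "('r::finite, 'n::finite) polX"
  assumes \<sigma>: "bij \<sigma>" and w: "\<And>k j. k \<noteq> \<sigma> j \<Longrightarrow> w $ k $ j = 0"
  shows "lookup (act w f) b =
    lookup f (Poly_Mapping.map_key (map_prod id \<sigma>) b) * (\<Prod>j\<in>UNIV. (w $ \<sigma> j $ j) ^ (\<Sum>i\<in>UNIV. lookup b (i, \<sigma> j)))"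
proof -
  have "(\<Sum>k\<in>UNIV. pscale (w $ k $ j) (pvar (i, k))) =
      (pscale (w $ \<sigma> j $ j) (pvar (i, \<sigma> j)) :: ('r, 'n) polX)" for i j
  proof -
    have "(\<Sum>k\<in>UNIV. pscale (w $ k $ j) (pvar (i, k))) =
        (\<Sum>k\<in>UNIV. if k = \<sigma> j then pscale (w $ \<sigma> j $ j) (pvar (i, \<sigma> j)) else 0 :: ('r, 'n) polX)"
      by (rule sum.cong) (use w in auto)
    then show ?thesis by simp
  qed
  then have "act w f =
      psubst (\<lambda>v. pscale (w $ \<sigma> (snd v) $ snd v) (pvar (map_prod id \<sigma> v))) f"
    unfolding act_def by (intro arg_cong[where f = "\<lambda>\<phi>. psubst \<phi> f"]) (auto simp: fun_eq_iff)
  moreover have "bij (map_prod id \<sigma> :: 'r \<times> 'n \<Rightarrow> 'r \<times> 'n)"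
    using \<sigma> by (simp add: bij_def prod.inj_map map_prod_surj)
  ultimately have "lookup (act w f) b = lookup f (Poly_Mapping.map_key (map_prod id \<sigma>) b) *
      (\<Prod>v\<in>UNIV. (w $ \<sigma> (snd v) $ snd v) ^ lookup b (map_prod id \<sigma> v))"
    by (simp only: lookup_psubst_monomial)
  also have "(\<Prod>v\<in>UNIV. (w $ \<sigma> (snd v) $ snd v) ^ lookup b (map_prod id \<sigma> v)) =
      (\<Prod>(i, j)\<in>UNIV \<times> UNIV. (w $ \<sigma> j $ j) ^ lookup b (i, \<sigma> j))"
    by (rule prod.cong) auto
  also have "(\<Prod>(i, j)\<in>UNIV \<times> UNIV. (w $ \<sigma> j $ j) ^ lookup b (i, \<sigma> j)) =
      (\<Prod>j\<in>UNIV. (w $ \<sigma> j $ j) ^ (\<Sum>i\<in>UNIV. lookup b (i, \<sigma> j)))"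
    by (subst prod.cartesian_product[symmetric], subst prod.swap) (simp add: power_sum)
  finally show ?thesis .
qed

text \<open>The forward direction evaluates at a primitive \<open>m\<close>-th root of unity
  \<zeta>, whose powers equal one exactly at the multiples of \<open>m\<close>.\<close>

lemma pow_eq_1_for_all_roots_iff:
  assumes "m > 0"
  shows "(\<forall>z::complex. z ^ m = 1 \<longrightarrow> z ^ k = 1) \<longleftrightarrow> m dvd k"
proof
  define \<zeta> :: complex where "\<zeta> = exp (2 * of_real pi * \<i> / of_nat m)"
  have "\<zeta> ^ k = exp (2 * of_real pi * \<i> * of_nat k / of_nat m)" for k
    unfolding \<zeta>_def exp_of_nat_mult[symmetric] by (simp add: ac_simps)
  then have \<zeta>: "\<zeta> ^ k = 1 \<longleftrightarrow> m dvd k" for k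
    using complex_root_unity_eq_1[of m k] assms by simp
  assume "\<forall>z::complex. z ^ m = 1 \<longrightarrow> z ^ k = 1"
  then have "\<zeta> ^ m = 1 \<longrightarrow> \<zeta> ^ k = 1" by (rule spec)
  then show "m dvd k" unfolding \<zeta> by simp
qed (auto simp: power_mult elim!: dvdE)

subsection \<open>Rank two\<close>

text \<open>The monomial x^u y^v in the two columns. The type \<open>2\<close> has just the elements
  \<open>1\<close> and \<open>2\<close>, so the \<open>else\<close> branch is the second column, and
  by \<open>combine_cases\<close> every exponent vector has this form.\<close>

definition combine :: "('r::finite \<Rightarrow>\<^sub>0 nat) \<Rightarrow> ('r \<Rightarrow>\<^sub>0 nat) \<Rightarrow> 'r \<times> 2 \<Rightarrow>\<^sub>0 nat" where
  "combine u v = Abs_poly_mapping (\<lambda>(i, j). if j = 1 then lookup u i else lookup v i)"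

lemma lookup_combine: "lookup (combine u v) (i, j) = (if j = 1 then lookup u i else lookup v i)"
  by (simp add: combine_def)

lemma combine_add: "combine (a + u) (b + v) = combine a b + combine u v"
  by (rule poly_mapping_eqI) (auto simp: lookup_combine lookup_add)

lemma combine_inject [simp]: "combine u v = combine u' v' \<longleftrightarrow> u = u' \<and> v = v'"
proof
  assume *: "combine u v = combine u' v'"
  have "lookup u i = lookup u' i \<and> lookup v i = lookup v' i" for i
    using arg_cong[OF *, of "\<lambda>a. lookup a (i, 1)"] arg_cong[OF *, of "\<lambda>a. lookup a (i, 2)"]
    by (simp add: lookup_combine)
  then show "u = u' \<and> v = v'" by (auto intro: poly_mapping_eqI)
qed simp

lemma combine_0 [simp]: "combine 0 0 = 0"
  by (rule poly_mapping_eqI) (auto simp: lookup_combine)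

lemma combine_eq_0_iff [simp]: "combine u v = 0 \<longleftrightarrow> u = 0 \<and> v = 0"
  using combine_inject[of u v 0 0] by simp

lemma combine_cases:
  fixes a :: "'r::finite \<times> 2 \<Rightarrow>\<^sub>0 nat"
  obtains u v where "a = combine u v"
proof
  have "inj (\<lambda>i::'r. (i, j))" for j :: 2 by (simp add: inj_def)
  then show "a = combine (Poly_Mapping.map_key (\<lambda>i. (i, 1)) a) (Poly_Mapping.map_key (\<lambda>i. (i, 2)) a)"
    by (intro poly_mapping_eqI) (use exhaust_2 in \<open>force simp: lookup_combine map_key.rep_eq\<close>)
qed

lemma all_combine: "(\<forall>a. Q a) \<longleftrightarrow> (\<forall>u v. Q (combine u v))"
  by (metis combine_cases)

lemma homog_part_combine_iff:
  "g \<in> homog_part d \<longleftrightarrow> (\<forall>u v. u + v \<noteq> d \<longrightarrow> dcoeff g (combine u v) = 0)"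
proof -
  have "(\<forall>i. (\<Sum>j\<in>UNIV. lookup (combine u v) (i, j)) = lookup d i) \<longleftrightarrow> u + v = d" for u v
    by (auto simp: sum_2 lookup_combine lookup_add poly_mapping_eq_iff fun_eq_iff)
  then show ?thesis
    unfolding homog_part_def mem_Collect_eq Ball_def all_combine in_keys_iff by (auto simp: dcoeff_eq_0_iff)
qed

text \<open>For \<open>m > 0\<close>, the possible pairs of nonzero entries of an element of
  G(m,p,2), diagonal or antidiagonal: the root conditions do not depend on the positions of the
  entries.\<close>

definition diag_roots :: "nat \<Rightarrow> nat \<Rightarrow> (complex \<times> complex) set" where
  "diag_roots m p = {(\<alpha>, \<beta>). \<alpha> ^ m = 1 \<and> \<beta> ^ m = 1 \<and> (\<alpha> * \<beta>) ^ (m div p) = 1}"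

text \<open>Only the column degrees matter: a diagonal matrix scales \<open>combine u v\<close> by
  \<open>\<alpha> ^ deg u * \<beta> ^ deg v\<close>.\<close>

definition diag_invariant :: "nat \<Rightarrow> nat \<Rightarrow> nat \<Rightarrow> nat \<Rightarrow> bool" where
  "diag_invariant m p k l \<longleftrightarrow> (\<forall>\<alpha> \<beta>. (\<alpha>, \<beta>) \<in> diag_roots m p \<longrightarrow> \<alpha> ^ k * \<beta> ^ l = 1)"

lemma diag_invariant_commute: "diag_invariant m p k l \<longleftrightarrow> diag_invariant m p l k"
proof -
  have "(\<beta>, \<alpha>) \<in> diag_roots m p" if "(\<alpha>, \<beta>) \<in> diag_roots m p" for \<alpha> \<beta>
    using that by (simp add: diag_roots_def mult.commute)
  then show ?thesis
    unfolding diag_invariant_def by (metis mult.commute)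
qed

lemma diag_invariant_1: "m > 0 \<Longrightarrow> diag_invariant m 1 k l \<longleftrightarrow> m dvd k \<and> m dvd l"
proof -
  assume m: "m > 0"
  have "diag_invariant m 1 k l \<longleftrightarrow>
      (\<forall>\<alpha>::complex. \<alpha> ^ m = 1 \<longrightarrow> \<alpha> ^ k = 1) \<and> (\<forall>\<beta>::complex. \<beta> ^ m = 1 \<longrightarrow> \<beta> ^ l = 1)"
    (is "_ \<longleftrightarrow> ?R")
  proof
    assume L: "diag_invariant m 1 k l"
    have "\<alpha> ^ k * \<beta> ^ l = 1" if "\<alpha> ^ m = 1" "\<beta> ^ m = 1" for \<alpha> \<beta> :: complex
      using L that unfolding diag_invariant_def diag_roots_def by (simp add: power_mult_distrib)
    \<comment> \<open>Setting one of the two roots to \<open>1\<close> separates the conditions on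
      \<open>k\<close> and \<open>l\<close>.\<close>
    from this[of _ 1] this[of 1] show ?R by auto
  qed (auto simp: diag_invariant_def diag_roots_def)
  with m show ?thesis by (simp add: pow_eq_1_for_all_roots_iff)
qed

text \<open>As \<open>m div m = 1\<close>, the two entries are mutually inverse, and the scalar
  becomes \<open>\<alpha> ^ (k - l)\<close>. Subtraction is truncated, so this is done for
  \<open>l \<le> k\<close> and the other case follows by symmetry.\<close>

lemma diag_invariant_self:
  assumes "m > 0"
  shows "diag_invariant m m k l \<longleftrightarrow> k mod m = l mod m"
proof -
  have "diag_invariant m m k l \<longleftrightarrow> m dvd (k - l)" if "l \<le> k" for k l
  proof -
    have "diag_invariant m m k l \<longleftrightarrow> (\<forall>\<alpha>::complex. \<alpha> ^ m = 1 \<longrightarrow> \<alpha> ^ (k - l) = 1)" (is "?L \<longleftrightarrow> ?R")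
    proof -
      have *: "\<alpha> ^ k * \<beta> ^ l = \<alpha> ^ (k - l)" if "\<alpha> * \<beta> = 1" for \<alpha> \<beta> :: complex
      proof -
        have "\<alpha> ^ k * \<beta> ^ l = \<alpha> ^ (k - l) * (\<alpha> ^ l * \<beta> ^ l)"
          using \<open>l \<le> k\<close> by (simp flip: power_add mult.assoc)
        then show ?thesis using that by (simp flip: power_mult_distrib)
      qed
      show ?thesis
      proof
        assume ?L
        then have "\<alpha> ^ k * inverse \<alpha> ^ l = 1" if "\<alpha> ^ m = 1" for \<alpha> :: complex
        proof -
          have "\<alpha> \<noteq> 0" using that assms by (auto simp: power_0_left)
          then have "(\<alpha>, inverse \<alpha>) \<in> diag_roots m m"
            using that assms by (simp add: diag_roots_def power_inverse)
          then show ?thesis using \<open>?L\<close> by (auto simp: diag_invariant_def)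
        qed
        then show ?R using * assms
          by (metis power_0_left right_inverse zero_neq_one less_numeral_extra(3))
      next
        assume ?R
        then show ?L using * assms by (auto simp: diag_invariant_def diag_roots_def)
      qed
    qed
    then show ?thesis using assms by (simp add: pow_eq_1_for_all_roots_iff)
  qed
  then show ?thesis
    by (metis diag_invariant_commute mod_eq_dvd_iff_nat nat_le_linear)
qed

section \<open>Elements of the groups in rank two\<close>

definition diag2 :: "complex \<Rightarrow> complex \<Rightarrow> complex ^ 2 ^ 2" where
  "diag2 \<alpha> \<beta> = vector [vector [\<alpha>, 0], vector [0, \<beta>]]"

definition antidiag2 :: "complex \<Rightarrow> complex \<Rightarrow> complex ^ 2 ^ 2" where
  "antidiag2 \<alpha> \<beta> = vector [vector [0, \<alpha>], vector [\<beta>, 0]]"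

lemma diag2_nth [simp]:
  "diag2 \<alpha> \<beta> $ 1 $ 1 = \<alpha>" "diag2 \<alpha> \<beta> $ 1 $ 2 = 0" "diag2 \<alpha> \<beta> $ 2 $ 1 = 0" "diag2 \<alpha> \<beta> $ 2 $ 2 = \<beta>"
  by (simp_all add: diag2_def)

lemma antidiag2_nth [simp]:
  "antidiag2 \<alpha> \<beta> $ 1 $ 1 = 0" "antidiag2 \<alpha> \<beta> $ 1 $ 2 = \<alpha>" "antidiag2 \<alpha> \<beta> $ 2 $ 1 = \<beta>"
  "antidiag2 \<alpha> \<beta> $ 2 $ 2 = 0"
  by (simp_all add: antidiag2_def)

lemma G_rank2:
  assumes "m > 0"
  shows "w \<in> G m p \<longleftrightarrow>
    (\<exists>\<alpha> \<beta>. (\<alpha>, \<beta>) \<in> diag_roots m p \<and> (w = diag2 \<alpha> \<beta> \<or> w = antidiag2 \<alpha> \<beta>))"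
proof -
  \<comment> \<open>On a two-element type, unique existence is exclusive disjunction.\<close>
  have ex1: "(\<exists>!j. Q j) \<longleftrightarrow> Q 1 \<noteq> Q 2" for Q :: "2 \<Rightarrow> bool"
  proof -
    have "(1::2) \<noteq> 2" by simp
    then show ?thesis by (metis exhaust_2)
  qed
  have mono: "monomial_matrix w \<longleftrightarrow>
      (\<exists>\<alpha> \<beta>. \<alpha> \<noteq> 0 \<and> \<beta> \<noteq> 0 \<and> (w = diag2 \<alpha> \<beta> \<or> w = antidiag2 \<alpha> \<beta>))" for w :: "complex ^ 2 ^ 2"
    by (auto simp: monomial_matrix_def ex1 forall_2 vec_eq_iff)
  have sets: "{(i, j). diag2 \<alpha> \<beta> $ i $ j \<noteq> 0} = {(1, 1), (2, 2)}"
    "{(i, j). antidiag2 \<alpha> \<beta> $ i $ j \<noteq> 0} = {(1, 2), (2, 1)}" if "\<alpha> \<noteq> 0" "\<beta> \<noteq> 0" for \<alpha> \<beta>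
    using that by (auto simp: set_eq_iff forall_2)
  have "diag2 \<alpha> \<beta> \<in> G m p \<longleftrightarrow> (\<alpha>, \<beta>) \<in> diag_roots m p"
    "antidiag2 \<alpha> \<beta> \<in> G m p \<longleftrightarrow> (\<alpha>, \<beta>) \<in> diag_roots m p" if "\<alpha> \<noteq> 0" "\<beta> \<noteq> 0" for \<alpha> \<beta>
    using that mono by (auto simp: G_def sets diag_roots_def forall_2)
  moreover have "\<alpha> \<noteq> 0 \<and> \<beta> \<noteq> 0" if "(\<alpha>, \<beta>) \<in> diag_roots m p" for \<alpha> \<beta>
    using that assms by (auto simp: diag_roots_def power_0_left)
  moreover have "w \<in> G m p \<Longrightarrow> monomial_matrix w" for w :: "complex ^ 2 ^ 2"
    by (simp add: G_def)
  ultimately show ?thesis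
    using mono by metis
qed

lemma lookup_act_diag2:
  "lookup (act (diag2 \<alpha> \<beta>) f) (combine u v) = lookup f (combine u v) * (\<alpha> ^ deg u * \<beta> ^ deg v)"
proof -
  have "diag2 \<alpha> \<beta> $ k $ j = 0" if "k \<noteq> id j" for k j
    using that exhaust_2[of k] exhaust_2[of j] by auto
  from lookup_act[where \<sigma> = id and f = f and b = "combine u v", OF bij_id this] show ?thesis
    by (simp add: UNIV_2 deg_def lookup_combine map_key_id prod.map_id0 id_def)
qed

lemma lookup_act_antidiag2:
  "lookup (act (antidiag2 \<alpha> \<beta>) f) (combine u v) = lookup f (combine v u) * (\<alpha> ^ deg u * \<beta> ^ deg v)"
proof -
  define \<sigma> :: "2 \<Rightarrow> 2" where "\<sigma> j = (if j = 1 then 2 else 1)" for j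
  have \<sigma>: "\<sigma> 1 = 2" "\<sigma> 2 = 1" by (simp_all add: \<sigma>_def)
  have inv: "\<sigma> (\<sigma> j) = j" for j using exhaust_2[of j] \<sigma> by auto
  then have bij: "bij \<sigma>" by (rule involuntory_imp_bij)
  then have inj: "inj (map_prod id \<sigma> :: 'a \<times> 2 \<Rightarrow> _)" by (simp add: bij_def prod.inj_map)
  have "Poly_Mapping.map_key (map_prod id \<sigma>) (combine u v) = combine v u"
    by (rule poly_mapping_eqI) (auto simp: map_key.rep_eq[OF inj] lookup_combine \<sigma>_def)
  moreover have "antidiag2 \<alpha> \<beta> $ k $ j = 0" if "k \<noteq> \<sigma> j" for k j
    using that exhaust_2[of k] exhaust_2[of j] \<sigma> by auto
  ultimately show ?thesis
    using lookup_act[OF bij, of "antidiag2 \<alpha> \<beta>" f "combine u v"] by (simp add: UNIV_2 deg_def lookup_combine \<sigma> mult.commute)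
qed

text \<open>Diagonal elements scale each monomial, and the swap matrix exchanges the columns. Every
  other antidiagonal element is a product of these two kinds, so it imposes nothing new.\<close>

lemma invariants_rank2_iff:
  fixes f :: "('r::finite, 2) polX"
  assumes "m > 0"
  shows "f \<in> invariants (G m p) \<longleftrightarrow>
    (\<forall>u v. lookup f (combine u v) = lookup f (combine v u) \<and>
      (lookup f (combine u v) \<noteq> 0 \<longrightarrow> diag_invariant m p (deg u) (deg v)))"
proof -
  have eq: "act w f = f \<longleftrightarrow> (\<forall>u v. lookup (act w f) (combine u v) = lookup f (combine u v))" for w
    unfolding poly_mapping_eq_iff fun_eq_iff all_combine ..
  have "f \<in> invariants (G m p) \<longleftrightarrow>
      (\<forall>\<alpha> \<beta>. (\<alpha>, \<beta>) \<in> diag_roots m p \<longrightarrow> (\<forall>u v.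
        lookup f (combine u v) * (\<alpha> ^ deg u * \<beta> ^ deg v) = lookup f (combine u v) \<and>
        lookup f (combine v u) * (\<alpha> ^ deg u * \<beta> ^ deg v) = lookup f (combine u v)))"
  proof -
    have "f \<in> invariants (G m p) \<longleftrightarrow>
        (\<forall>\<alpha> \<beta>. (\<alpha>, \<beta>) \<in> diag_roots m p \<longrightarrow> act (diag2 \<alpha> \<beta>) f = f \<and> act (antidiag2 \<alpha> \<beta>) f = f)"
      unfolding invariants_def mem_Collect_eq Ball_def G_rank2[OF assms] by blast
    then show ?thesis
      unfolding eq lookup_act_diag2 lookup_act_antidiag2 by blast
  qed
  also have "\<dots> \<longleftrightarrow> (\<forall>u v. lookup f (combine u v) = lookup f (combine v u) \<and>
      (lookup f (combine u v) \<noteq> 0 \<longrightarrow> diag_invariant m p (deg u) (deg v)))"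
    (is "?L \<longleftrightarrow> ?R")
  proof
    assume L: ?L
    \<comment> \<open>The antidiagonal matrix for \<open>(1, 1)\<close> is the swap of the
      columns.\<close>
    have "(1, 1) \<in> diag_roots m p" by (simp add: diag_roots_def)
    with L have "lookup f (combine u v) = lookup f (combine v u)" for u v
      by force
    moreover have "diag_invariant m p (deg u) (deg v)" if "lookup f (combine u v) \<noteq> 0" for u v
      using L that unfolding diag_invariant_def by fastforce
    ultimately show ?R by blast
  next
    assume R: ?R
    then show ?L unfolding diag_invariant_def by (metis mult.right_neutral mult_zero_left)
  qed
  finally show ?thesis .
qed

text \<open>Invariants are combinations of the symmetrized monomials x^a y^b + x^b y^a with x^a y^b
  fixed by the diagonal matrices; the right-hand side is orthogonality to all monomial multiples of
  these.\<close>

lemma harmonics_rank2_iff: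
  fixes g :: "('r::finite, 2) polX"
  assumes "m > 0"
  shows "g \<in> harmonics (G m p) \<longleftrightarrow>
    (\<forall>a b u v. (a, b) \<noteq> (0, 0) \<longrightarrow> diag_invariant m p (deg a) (deg b) \<longrightarrow>
      dcoeff g (combine (a + u) (b + v)) + dcoeff g (combine (b + u) (a + v)) = 0)"
    (is "_ \<longleftrightarrow> ?R")
proof
  assume g: "g \<in> harmonics (G m p)"
  show ?R
  proof (intro allI impI)
    fix a b u v :: "'r \<Rightarrow>\<^sub>0 nat"
    assume ne: "(a, b) \<noteq> (0, 0)" and inv: "diag_invariant m p (deg a) (deg b)"
    have inv': "diag_invariant m p (deg b) (deg a)"
      using inv by (rule diag_invariant_commute[THEN iffD1])
    \<comment> \<open>For \<open>a = b\<close> this is twice a monomial, matching the doubled term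
      of the relation.\<close>
    define f :: "('r, 2) polX" where "f = single (combine a b) 1 + single (combine b a) 1"
    have lookup_f: "lookup f (combine x y) = of_bool (a = x \<and> b = y) + of_bool (b = x \<and> a = y)"
      for x y
      unfolding f_def lookup_add lookup_single when_def combine_inject of_bool_def ..
    have "f \<in> invariants (G m p)"
      unfolding invariants_rank2_iff[OF assms] lookup_f
    proof (intro allI conjI impI)
      fix x y
      show "of_bool (a = x \<and> b = y) + of_bool (b = x \<and> a = y) =
          (of_bool (a = y \<and> b = x) + of_bool (b = y \<and> a = x) :: complex)"
        by (simp only: conj_commute add.commute)
      assume "of_bool (a = x \<and> b = y) + of_bool (b = x \<and> a = y) \<noteq> (0 :: complex)"
      then have "x = a \<and> y = b \<or> x = b \<and> y = a"
        by (auto simp: of_bool_def split: if_splits)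
      then show "diag_invariant m p (deg x) (deg y)"
        using inv inv' by blast
    qed
    moreover have "lookup f 0 = 0"
      using ne by (auto simp: f_def lookup_add lookup_single when_def)
    ultimately have "apply_diff f g = 0"
      using g unfolding harmonics_iff by blast
    then have "dcoeff (apply_diff f g) (combine u v) = 0"
      by simp
    then show "dcoeff g (combine (a + u) (b + v)) + dcoeff g (combine (b + u) (a + v)) = 0"
      by (simp add: f_def apply_diff_add dcoeff_add dcoeff_apply_diff_single combine_add)
  qed
next
  assume R: ?R
  show "g \<in> harmonics (G m p)"
    unfolding harmonics_iff
  proof (intro ballI impI)
    fix f :: "('r, 2) polX"
    assume f: "f \<in> invariants (G m p)" and f0: "lookup f 0 = 0"
    have sym: "lookup f (combine u v) = lookup f (combine v u)" for u v
      using f unfolding invariants_rank2_iff[OF assms] by blast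
    have inv: "diag_invariant m p (deg u) (deg v)" if "lookup f (combine u v) \<noteq> 0" for u v
      using f that unfolding invariants_rank2_iff[OF assms] by blast
    define Q where "Q = {(u, v). lookup f (combine u v) \<noteq> 0}"
    have Q: "bij_betw (\<lambda>(u, v). combine u v) Q (keys f)"
      unfolding bij_betw_def
    proof
      show "inj_on (\<lambda>(u, v). combine u v) Q" by (auto simp: inj_on_def)
      show "(\<lambda>(u, v). combine u v) ` Q = keys f"
        by (auto simp: Q_def in_keys_iff image_iff) (metis combine_cases)
    qed
    have swap: "bij_betw prod.swap Q Q"
      by (rule bij_betw_byWitness[where f' = prod.swap]) (use sym in \<open>auto simp: Q_def\<close>)
    have "dcoeff (apply_diff f g) (combine x y) = 0" for x y
    proof -
      \<comment> \<open>\<open>?F'\<close> is \<open>?F\<close> reindexed by the swap, using the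
        symmetry of \<open>f\<close>. The two sums agree and cancel termwise, so both
        vanish.\<close>
      let ?F = "\<lambda>(u, v). lookup f (combine u v) * dcoeff g (combine (u + x) (v + y))"
      let ?F' = "\<lambda>(u, v). lookup f (combine u v) * dcoeff g (combine (v + x) (u + y))"
      have 1: "dcoeff (apply_diff f g) (combine x y) = sum ?F Q"
        unfolding dcoeff_apply_diff sum.reindex_bij_betw[OF Q, symmetric]
        by (simp add: case_prod_beta combine_add)
      have 2: "sum ?F Q = sum ?F' Q"
        unfolding sum.reindex_bij_betw[OF swap, of ?F, symmetric]
        by (rule sum.cong) (auto simp: sym)
      have "?F q + ?F' q = 0" if "q \<in> Q" for q
      proof -
        obtain u v where q: "q = (u, v)" by fastforce
        then have nz: "lookup f (combine u v) \<noteq> 0" using that by (simp add: Q_def)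
        with f0 have "(u, v) \<noteq> (0, 0)" by auto
        with R inv[OF nz] have "dcoeff g (combine (u + x) (v + y)) + dcoeff g (combine (v + x) (u + y)) = 0"
          by blast
        then show ?thesis by (simp add: q flip: distrib_left)
      qed
      then have "sum ?F Q + sum ?F' Q = 0"
        by (simp flip: sum.distrib)
      with 1 2 show ?thesis by simp
    qed
    then have "dcoeff (apply_diff f g) a = 0" for a
      by (metis combine_cases)
    then show "apply_diff f g = 0"
      by (rule dcoeff_eq_0D)
  qed
qed

text \<open>Transport of \<open>dim_eq_card_classes\<close> along the bijection between pairs of
  exponent vectors and exponent vectors on \<open>'r \<times> 2\<close>.\<close>

lemma dim_eq_card_pair_classes:
  fixes P :: "'k \<Rightarrow> (('r::finite \<Rightarrow>\<^sub>0 nat) \<times> ('r \<Rightarrow>\<^sub>0 nat)) set"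
    and \<epsilon> :: "('r \<Rightarrow>\<^sub>0 nat) \<Rightarrow> ('r \<Rightarrow>\<^sub>0 nat) \<Rightarrow> complex"
  assumes K: "finite K" and disj: "disjoint_family_on P K"
    and fin: "\<And>k. k \<in> K \<Longrightarrow> finite (P k)" and ne: "\<And>k. k \<in> K \<Longrightarrow> P k \<noteq> {}"
    and \<epsilon>: "\<And>u v. \<epsilon> u v \<noteq> 0"
    and V: "\<And>g. g \<in> V \<longleftrightarrow>
      (\<forall>u v. (u, v) \<notin> (\<Union>k\<in>K. P k) \<longrightarrow> dcoeff g (combine u v) = 0) \<and>
      (\<forall>k\<in>K. \<forall>(u, v)\<in>P k. \<forall>(u', v')\<in>P k.
        \<epsilon> u' v' * dcoeff g (combine u v) = \<epsilon> u v * dcoeff g (combine u' v'))"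
  shows "mpol.dim V = card K"
proof -
  define pr where "pr = inv (\<lambda>(u, v). combine u v :: 'r \<times> 2 \<Rightarrow>\<^sub>0 nat)"
  have inj: "inj (\<lambda>(u, v). combine u v :: 'r \<times> 2 \<Rightarrow>\<^sub>0 nat)"
    by (auto simp: inj_def)
  have pr: "pr (combine u v) = (u, v)" for u v
    unfolding pr_def using inv_f_f[OF inj, of "(u, v)"] by simp
  show ?thesis
  proof (rule dim_eq_card_classes[where P = "\<lambda>k. pr -` P k" and \<epsilon> = "\<lambda>a. case_prod \<epsilon> (pr a)"])
    show "finite (pr -` P k)" if "k \<in> K" for k
    proof (rule finite_subset)
      show "pr -` P k \<subseteq> (\<lambda>(u, v). combine u v) ` P k"
      proof
        fix a assume "a \<in> pr -` P k"
        then show "a \<in> (\<lambda>(u, v). combine u v) ` P k"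
          by (cases a rule: combine_cases) (force simp: pr)
      qed
    qed (use fin that in simp)
    show "pr -` P k \<noteq> {}" if "k \<in> K" for k
      using ne[OF that] pr by fastforce
    show "g \<in> V \<longleftrightarrow> (\<forall>p. p \<notin> (\<Union>k\<in>K. pr -` P k) \<longrightarrow> dcoeff g p = 0) \<and>
      (\<forall>k\<in>K. \<forall>p\<in>pr -` P k. \<forall>q\<in>pr -` P k.
        case_prod \<epsilon> (pr q) * dcoeff g p = case_prod \<epsilon> (pr p) * dcoeff g q)" for g
      unfolding V Ball_def all_combine by (auto simp: pr)
    show "disjoint_family_on (\<lambda>k. pr -` P k) K"
      using disj unfolding disjoint_family_on_def by blast
  qed (use K \<epsilon> in \<open>auto split: prod.splits\<close>)
qed

subsection \<open>Rank one\<close>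

lemma G_rank1:
  assumes "m > 0"
  shows "w \<in> (G m 1 :: (complex ^ 1 ^ 1) set) \<longleftrightarrow> (w $ 1 $ 1) ^ m = 1"
proof -
  have ex1: "(\<exists>!j::1. Q j) \<longleftrightarrow> Q 1" for Q
    unfolding Ex1_def forall_1 by (metis num1_eq1)
  have set: "{(i, j). w $ i $ j \<noteq> 0} = (if w $ 1 $ 1 \<noteq> 0 then {(1, 1)} else {})"
    by (auto simp: set_eq_iff forall_1)
  have "w $ 1 $ 1 \<noteq> 0" if "(w $ 1 $ 1) ^ m = 1"
    using that assms by (auto simp: power_0_left)
  then show ?thesis
    unfolding G_def monomial_matrix_def mem_Collect_eq ex1 set forall_1 by auto
qed

lemma deg_rank1: "deg (a :: 'r::finite \<times> 1 \<Rightarrow>\<^sub>0 nat) = (\<Sum>i\<in>UNIV. lookup a (i, 1))"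
proof -
  have "deg a = sum (lookup a) (UNIV \<times> UNIV)" unfolding deg_def UNIV_Times_UNIV ..
  also have "\<dots> = (\<Sum>i\<in>UNIV. \<Sum>j\<in>UNIV. lookup a (i, j))"
    unfolding sum.cartesian_product by (rule sum.cong) auto
  finally show ?thesis by (simp only: sum_1)
qed

text \<open>An entry \<open>z\<close> multiplies the monomial with exponent \<open>a\<close> by
  \<open>z ^ deg a\<close>, so coefficients are tested one by one against all \<open>m\<close>-th
  roots of unity.\<close>

lemma invariants_rank1_iff:
  fixes f :: "('r::finite, 1) polX"
  assumes "m > 0"
  shows "f \<in> invariants (G m 1) \<longleftrightarrow> (\<forall>a. lookup f a \<noteq> 0 \<longrightarrow> m dvd deg a)"
proof -
  have act: "lookup (act w f) a = lookup f a * (w $ 1 $ 1) ^ deg a" for w a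
  proof -
    have "w $ k $ j = 0" if "k \<noteq> id j" for k j :: 1
      using that num1_eq1[of k] num1_eq1[of j] by simp
    from lookup_act[where f = f and b = a, OF bij_id this] show ?thesis
      unfolding deg_rank1 by (simp add: UNIV_1 prod.map_id0 id_def map_key_id)
  qed
  have "f \<in> invariants (G m 1) \<longleftrightarrow>
      (\<forall>w :: complex ^ 1 ^ 1. (w $ 1 $ 1) ^ m = 1 \<longrightarrow> (\<forall>a. lookup f a * (w $ 1 $ 1) ^ deg a = lookup f a))"
    unfolding invariants_def mem_Collect_eq Ball_def G_rank1[OF assms] poly_mapping_eq_iff
      fun_eq_iff act by (rule refl)
  also have "\<dots> \<longleftrightarrow> (\<forall>z::complex. z ^ m = 1 \<longrightarrow> (\<forall>a. lookup f a * z ^ deg a = lookup f a))"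
    (is "?L \<longleftrightarrow> ?R")
  proof
    assume L: ?L
    show ?R
    proof (intro allI impI)
      fix z :: complex and a assume "z ^ m = 1"
      then show "lookup f a * z ^ deg a = lookup f a"
        using L[rule_format, of "\<chi> i j. z" a] by simp
    qed
  qed blast
  also have "\<dots> \<longleftrightarrow> (\<forall>a. lookup f a \<noteq> 0 \<longrightarrow> (\<forall>z::complex. z ^ m = 1 \<longrightarrow> z ^ deg a = 1))"
    by auto
  finally show ?thesis
    by (simp only: pow_eq_1_for_all_roots_iff[OF assms])
qed

text \<open>A monomial of degree at least \<open>m\<close> has a divisor of degree exactly
  \<open>m\<close>, and that divisor is invariant. Conversely, every monomial of an invariant
  without constant term has degree at least \<open>m\<close>.\<close>

lemma harmonics_rank1_iff:
  fixes g :: "('r::finite, 1) polX"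
  assumes "m > 0"
  shows "g \<in> harmonics (G m 1) \<longleftrightarrow> (\<forall>a. m \<le> deg a \<longrightarrow> dcoeff g a = 0)"
proof
  assume g: "g \<in> harmonics (G m 1)"
  show "\<forall>a. m \<le> deg a \<longrightarrow> dcoeff g a = 0"
  proof (intro allI impI)
    fix b :: "'r \<times> 1 \<Rightarrow>\<^sub>0 nat" assume "m \<le> deg b"
    then obtain a w where b: "b = a + w" "deg a = m" using deg_split by blast
    let ?f = "single a 1 :: ('r, 1) polX"
    have "?f \<in> invariants (G m 1)"
      unfolding invariants_rank1_iff[OF assms] using b(2) by (auto simp: lookup_single when_def)
    moreover have "lookup ?f 0 = 0"
      using b(2) assms by (auto simp: lookup_single when_def)
    ultimately have "apply_diff ?f g = 0"
      using g unfolding harmonics_iff by blast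
    then show "dcoeff g b = 0"
      using dcoeff_apply_diff_single[of a 1 g w] b(1) by simp
  qed
next
  assume g: "\<forall>a. m \<le> deg a \<longrightarrow> dcoeff g a = 0"
  show "g \<in> harmonics (G m 1)"
    unfolding harmonics_iff apply_diff_eq_0_iff
  proof (intro ballI impI allI sum.neutral)
    fix f :: "('r, 1) polX" and b a
    assume f: "f \<in> invariants (G m 1)" "lookup f 0 = 0" "a \<in> keys f"
    then have "m dvd deg a" unfolding invariants_rank1_iff[OF assms] by (simp add: in_keys_iff)
    moreover have "a \<noteq> 0" using f by (auto simp: in_keys_iff)
    ultimately have "m \<le> deg a" by (intro dvd_imp_le) simp_all
    then have "m \<le> deg (a + b)" by simp
    then have "dcoeff g (a + b) = 0" using g by blast
    then show "lookup f a * dcoeff g (a + b) = 0" by simp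
  qed
qed

lemma dim_harmonics_rank1:
  fixes d :: "'r::finite \<Rightarrow>\<^sub>0 nat"
  assumes "m > 0"
  shows "mpol.dim (harmonics (G m 1) \<inter> (homog_part d :: ('r, 1) polX set)) = of_bool (deg d < m)"
proof -
  \<comment> \<open>\<open>e\<close> is the only exponent of multidegree \<open>d\<close>, as each
    row of \<open>X\<close> has a single variable.\<close>
  define e :: "'r \<times> 1 \<Rightarrow>\<^sub>0 nat" where "e = Abs_poly_mapping (\<lambda>(i, j). lookup d i)"
  have e: "lookup e (i, j) = lookup d i" for i j by (simp add: e_def)
  have deg_e: "deg e = deg d" by (simp add: deg_rank1 e deg_def)
  have "(\<forall>i. (\<Sum>j\<in>UNIV. lookup a (i, j)) = lookup d i) \<longleftrightarrow> a = e" for a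
    by (auto simp: poly_mapping_eq_iff fun_eq_iff e sum_1 forall_1)
  then have homog: "g \<in> homog_part d \<longleftrightarrow> (\<forall>a. a \<noteq> e \<longrightarrow> dcoeff g a = 0)" for g
    by (auto simp: homog_part_def in_keys_iff dcoeff_eq_0_iff)
  have "g \<in> harmonics (G m 1) \<inter> homog_part d \<longleftrightarrow>
      (\<forall>a. a = e \<and> deg d < m \<or> dcoeff g a = 0)" for g
    unfolding Int_iff harmonics_rank1_iff[OF assms] homog using deg_e by (metis not_le)
  then have "mpol.dim (harmonics (G m 1) \<inter> (homog_part d :: ('r, 1) polX set)) =
      card (if deg d < m then {e} else {})"
    by (intro dim_eq_card_classes[where P = "\<lambda>k. {k}" and \<epsilon> = "\<lambda>_. 1"])
      (auto simp: disjoint_family_on_def)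
  then show ?thesis by simp
qed

subsection \<open>The dihedral groups\<close>

lemma deg_eq_1_imp_single:
  assumes "deg u = 1" "lookup u i \<noteq> 0"
  shows "u = single i 1"
proof -
  have *: "single i 1 + (u - single i 1) = u"
    using assms(2) by (intro poly_mapping_eqI) (auto simp: lookup_add lookup_minus lookup_single when_def)
  have "deg (single i 1) + deg (u - single i 1) = 1"
    by (simp only: deg_add[symmetric] * assms(1))
  then have "u - single i 1 = 0" by simp
  with * show ?thesis by simp
qed

text \<open>Unique factorization of a product of two variables; it bounds the set \<open>M\<close>
  of the dihedral count by two elements.\<close>

lemma deg_1_add_eq_iff:
  assumes "deg u = 1" "deg v = 1" "deg x = 1" "deg y = 1"
  shows "x + y = u + v \<longleftrightarrow> x = u \<and> y = v \<or> x = v \<and> y = u"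
proof
  assume *: "x + y = u + v"
  obtain i where i: "lookup x i \<noteq> 0"
    using assms(3) by (metis deg_zero lookup_zero poly_mapping_eqI zero_neq_one)
  have "lookup u i + lookup v i = lookup x i + lookup y i"
    by (simp add: * flip: lookup_add)
  with i have "lookup u i \<noteq> 0 \<or> lookup v i \<noteq> 0" by linarith
  then have "x = u \<or> x = v"
    using deg_eq_1_imp_single assms i by metis
  with * show "x = u \<and> y = v \<or> x = v \<and> y = u"
    by (metis add.commute add_left_cancel)
qed (auto simp: add.commute)

text \<open>Moving degree-one factors between the two sides changes the sign; going around a three-cycle
  of such moves gives \<open>c = -c\<close>, which kills every mixed monomial of total degree at least three.\<close>

lemma swap_antisymmetric_eq_0:
  fixes c :: "('r::finite \<Rightarrow>\<^sub>0 nat) \<Rightarrow> ('r \<Rightarrow>\<^sub>0 nat) \<Rightarrow> complex"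
  assumes swap: "\<And>a b u v. deg a = 1 \<Longrightarrow> deg b = 1 \<Longrightarrow> c (a + u) (b + v) + c (b + u) (a + v) = 0"
    and "2 \<le> deg u" "1 \<le> deg v"
  shows "c u v = 0"
proof -
  have "1 \<le> deg u" using assms by simp
  then obtain x u1 where u1: "u = x + u1" "deg x = 1" using deg_split by blast
  then have "1 \<le> deg u1" using assms(2) by (simp add: deg_add)
  then obtain y w where u2: "u1 = y + w" "deg y = 1" using deg_split by blast
  obtain z t where v: "v = z + t" "deg z = 1" using deg_split[OF assms(3)] by blast
  have "c (x + (y + w)) (z + t) + c (z + (y + w)) (x + t) = 0"
    "c (y + (z + w)) (x + t) + c (x + (z + w)) (y + t) = 0"
    "c (z + (x + w)) (y + t) + c (y + (x + w)) (z + t) = 0"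
    using swap u1 u2 v by blast+
  moreover have "z + (y + w) = y + (z + w)" "x + (z + w) = z + (x + w)" "y + (x + w) = x + (y + w)"
    by (simp_all only: ac_simps)
  ultimately have "c (x + (y + w)) (z + t) + c (x + (y + w)) (z + t) = 0"
    by (metis add.commute add_eq_0_iff)
  then show ?thesis using u1 u2 v by simp
qed

text \<open>Exchanging variables kills the mixed monomials of degree at least three and makes
  \<open>c\<close> antisymmetric on products of two variables. Moving a factor of degree
  \<open>m\<close> links the pure monomials of degree \<open>m\<close> and turns larger pure ones
  into mixed ones. Every other relation involves only monomials on which \<open>c\<close>
  vanishes.\<close>

lemma dihedral_relations_iff:
  fixes c :: "('r::finite \<Rightarrow>\<^sub>0 nat) \<Rightarrow> ('r \<Rightarrow>\<^sub>0 nat) \<Rightarrow> complex"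
  assumes m: "2 \<le> m"
  shows "(\<forall>a b u v. (a, b) \<noteq> (0, 0) \<longrightarrow> deg a mod m = deg b mod m \<longrightarrow>
      c (a + u) (b + v) + c (b + u) (a + v) = 0) \<longleftrightarrow>
    (\<forall>u v. u \<noteq> 0 \<longrightarrow> v \<noteq> 0 \<longrightarrow> 3 \<le> deg u + deg v \<longrightarrow> c u v = 0) \<and>
    (\<forall>u v. deg u = 1 \<longrightarrow> deg v = 1 \<longrightarrow> c u v + c v u = 0) \<and>
    (\<forall>u. m < deg u \<longrightarrow> c u 0 = 0 \<and> c 0 u = 0) \<and>
    (\<forall>u. deg u = m \<longrightarrow> c u 0 + c 0 u = 0)"
    (is "?L \<longleftrightarrow> ?mixed \<and> ?one \<and> ?large \<and> ?top")
proof
  assume L: ?L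
  have rel: "c (a + u) (b + v) + c (b + u) (a + v) = 0"
    if "deg a \<noteq> 0" "deg a mod m = deg b mod m" for a b u v
    using L[rule_format, of a b u v] that by auto
  have swap: "c (a + u) (b + v) + c (b + u) (a + v) = 0" if "deg a = 1" "deg b = 1" for a b u v
    using rel[of a b u v] that by simp
  have mixed: "c u v = 0" if "u \<noteq> 0" "v \<noteq> 0" "3 \<le> deg u + deg v" for u v
  proof (cases "2 \<le> deg u")
    case True
    moreover have "deg v \<noteq> 0" using that by simp
    then have "1 \<le> deg v" by linarith
    ultimately show ?thesis
      by (intro swap_antisymmetric_eq_0[of c] swap)
  next
    \<comment> \<open>Here the second column has degree at least two, and the columns exchange
      roles.\<close>
    case False
    moreover have "deg u \<noteq> 0" using that by simp
    ultimately have "2 \<le> deg v" "1 \<le> deg u" using that(3) by linarith+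
    then show ?thesis
      using swap_antisymmetric_eq_0[of "\<lambda>u v. c v u" v u] swap by blast
  qed
  have top: "c (a + u) 0 + c u a = 0" "c a u + c 0 (a + u) = 0" if "deg a = m" for a u
    using rel[of a 0 u 0] rel[of a 0 0 u] that m by auto
  \<comment> \<open>Moving a degree-\<open>m\<close> divisor to the other column leaves a mixed
    monomial of degree above \<open>m \<ge> 2\<close>, already known to vanish.\<close>
  have large: "c u 0 = 0 \<and> c 0 u = 0" if "m < deg u" for u
  proof -
    have "m \<le> deg u" using that by linarith
    then obtain a w where aw: "u = a + w" "deg a = m" using deg_split by blast
    then have "w \<noteq> 0" "a \<noteq> 0" using that m by auto
    moreover have "3 \<le> deg a + deg w" using aw that m by (simp only: deg_add)
    ultimately have "c w a = 0" "c a w = 0" using mixed[of w a] mixed[of a w] by simp_all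
    with top[OF aw(2), of w] aw show ?thesis by simp
  qed
  have "c u v + c v u = 0" if "deg u = 1" "deg v = 1" for u v
    using swap[OF that, of 0 0] by simp
  moreover have "c u 0 + c 0 u = 0" if "deg u = m" for u
    using top(1)[OF that, of 0] by simp
  ultimately show "?mixed \<and> ?one \<and> ?large \<and> ?top"
    using mixed large by blast
next
  assume R: "?mixed \<and> ?one \<and> ?large \<and> ?top"
  then have mixed: "c u v = 0" if "deg u \<noteq> 0" "deg v \<noteq> 0" "3 \<le> deg u + deg v" for u v
    using that by (metis deg_eq_0_iff)
  from R have one: "c u v + c v u = 0" if "deg u = 1" "deg v = 1" for u v
    using that by blast
  from R have large: "c u 0 = 0" "c 0 u = 0" if "m < deg u" for u
    using that by blast+
  from R have top: "c u 0 + c 0 u = 0" if "deg u = m" for u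
    using that by blast
  have rel0: "c (a + u) v + c u (a + v) = 0" if a: "a \<noteq> 0" "m dvd deg a" for a u v
  proof -
    have "m \<le> deg a"
      using a deg_eq_0_iff[of a] by (metis bot_nat_0.not_eq_extremum dvd_imp_le)
    \<comment> \<open>Total degree above \<open>m\<close> is at least three, which kills mixed
      monomials, and pure ones are killed as well.\<close>
    have zero: "c (a + u) v = 0" "c u (a + v) = 0" if "m < deg a + deg u + deg v" for u v
    proof -
      show "c (a + u) v = 0"
        by (cases "v = 0") (use that \<open>m \<le> deg a\<close> m in \<open>auto intro!: large mixed\<close>)
      show "c u (a + v) = 0"
        by (cases "u = 0") (use that \<open>m \<le> deg a\<close> m in \<open>auto intro!: large mixed\<close>)
    qed
    show ?thesis
    proof (cases "m < deg a + deg u + deg v")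
      case True
      then show ?thesis using zero by simp
    next
      case False
      with \<open>m \<le> deg a\<close> have "deg a = m" "deg u = 0" "deg v = 0" by linarith+
      then show ?thesis using top by simp
    qed
  qed
  show ?L
  proof (intro allI impI)
    fix a b u v :: "'r \<Rightarrow>\<^sub>0 nat"
    assume ab: "(a, b) \<noteq> (0, 0)" "deg a mod m = deg b mod m"
    consider "a = 0" | "b = 0" | "a \<noteq> 0" "b \<noteq> 0" by blast
    then show "c (a + u) (b + v) + c (b + u) (a + v) = 0"
    proof cases
      case 1
      then show ?thesis using ab rel0[of b u v] by (simp add: add.commute mod_eq_0_iff_dvd)
    next
      case 2
      then show ?thesis using ab rel0[of a u v] by (simp add: mod_eq_0_iff_dvd)
    next
      case 3
      then have "deg a \<noteq> 0" "deg b \<noteq> 0" by simp_all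
      show ?thesis
      proof (cases "deg (a + b + u + v) = 2")
        case True
        then have "deg a = 1" "deg b = 1" "deg u = 0" "deg v = 0"
          using \<open>deg a \<noteq> 0\<close> \<open>deg b \<noteq> 0\<close> unfolding deg_add by linarith+
        then show ?thesis using one by simp
      next
        case False
        then have "3 \<le> deg a + deg b + deg u + deg v"
          using \<open>deg a \<noteq> 0\<close> \<open>deg b \<noteq> 0\<close> unfolding deg_add by linarith
        then have "c (a + u) (b + v) = 0" "c (b + u) (a + v) = 0"
          using \<open>deg a \<noteq> 0\<close> \<open>deg b \<noteq> 0\<close> by (intro mixed; simp only: deg_add; linarith)+
        then show ?thesis by simp
      qed
    qed
  qed
qed

text \<open>\<open>M\<close> is empty, \<open>{(u, u)}\<close> or \<open>{(u, v), (v, u)}\<close>,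
  and antisymmetry leaves a free scalar only in the last case. Natural subtraction makes
  \<open>card M - 1\<close> equal to \<open>0\<close>, \<open>0\<close> and \<open>1\<close>
  accordingly. The first summand counts the classes of pure monomials.\<close>

lemma dim_harmonics_dihedral:
  fixes d :: "'r::finite \<Rightarrow>\<^sub>0 nat"
  assumes m: "2 \<le> m"
  defines "M \<equiv> {(u, v). u + v = d \<and> deg u = 1 \<and> deg v = 1}"
  shows "mpol.dim (harmonics (G m m) \<inter> (homog_part d :: ('r, 2) polX set)) =
    (if d = 0 then 1 else if deg d < m then 2 else of_bool (deg d = m)) + (card M - 1)"
proof -
  have MD: "u + v = d" "deg u = 1" "deg v = 1" "u \<noteq> 0" "v \<noteq> 0" "deg d = 2" "(v, u) \<in> M"
    if "(u, v) \<in> M" for u v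
    using that by (auto simp: M_def add.commute)
  have M_eq: "M = {(u, v), (v, u)}" if uv: "(u, v) \<in> M" for u v
  proof -
    have "(x, y) \<in> M \<longleftrightarrow> (x, y) = (u, v) \<or> (x, y) = (v, u)" for x y
    proof
      assume xy: "(x, y) \<in> M"
      have "x + y = u + v" by (simp only: MD(1)[OF uv] MD(1)[OF xy])
      then show "(x, y) = (u, v) \<or> (x, y) = (v, u)"
        using deg_1_add_eq_iff MD(2,3)[OF uv] MD(2,3)[OF xy] by blast
    qed (use uv MD(7)[OF uv] in auto)
    then show ?thesis by auto
  qed
  \<comment> \<open>arbitrary, possibly \<open>0\<close>, if \<open>M\<close> is empty; hence the conjunct \<open>u \<noteq> 0\<close> in \<open>\<epsilon>\<close>\<close>
  define x0 where "x0 = fst (SOME q. q \<in> M)"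
  \<comment> \<open>For \<open>d = 0\<close> the two singletons coincide, which gives the separate
    case in the formula. In degree \<open>m\<close> the relation joins the two pure monomials into
    one class.\<close>
  define K1 where "K1 = (if deg d < m then {{(d, 0)}, {(0, d)}}
    else if deg d = m then {{(d, 0), (0, d)}} else {})"
  define K2 where "K2 = (if \<exists>u v. (u, v) \<in> M \<and> u \<noteq> v then {M} else {})"
  define K where "K = K1 \<union> K2"
  \<comment> \<open>Opposite signs on the members of a two-element class: the one whose first column
    is \<open>d\<close> or \<open>x0\<close> receives \<open>1\<close>.\<close>
  define \<epsilon> :: "('r \<Rightarrow>\<^sub>0 nat) \<Rightarrow> ('r \<Rightarrow>\<^sub>0 nat) \<Rightarrow> complex" where
    "\<epsilon> u v = (if u \<noteq> 0 \<and> (u = d \<or> u = x0) then 1 else -1)" for u v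
  have \<epsilon>_nz: "\<epsilon> u v \<noteq> 0" for u v by (simp add: \<epsilon>_def)
  have \<epsilon>_top: "\<epsilon> d 0 = 1" "\<epsilon> 0 d = -1" if "deg d = m"
    using that m by (auto simp: \<epsilon>_def)
  have \<epsilon>_M: "\<epsilon> u v = - \<epsilon> v u" if uv: "(u, v) \<in> M" "u \<noteq> v" for u v
  proof -
    have "(SOME q. q \<in> M) \<in> M" using uv(1) by (rule someI)
    then have "x0 = u \<or> x0 = v" unfolding x0_def using M_eq[OF uv(1)] by auto
    moreover have "u \<noteq> d" "v \<noteq> d" using MD[OF uv(1)] by auto
    ultimately show ?thesis using MD(4,5)[OF uv(1)] uv(2) by (auto simp: \<epsilon>_def)
  qed
  have inK: "(u, v) \<in> \<Union>K \<longleftrightarrow> u + v = d \<and> (u = 0 \<or> v = 0) \<and> deg d \<le> m \<or> (u, v) \<in> M \<and> u \<noteq> v" for u v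
  proof -
    have "(u, v) \<in> \<Union>K1 \<longleftrightarrow> u + v = d \<and> (u = 0 \<or> v = 0) \<and> deg d \<le> m"
      by (auto simp: K1_def)
    moreover have "(u, v) \<in> \<Union>K2 \<longleftrightarrow> (u, v) \<in> M \<and> u \<noteq> v"
    proof
      assume "(u, v) \<in> \<Union>K2"
      then obtain x y where *: "(u, v) \<in> M" "(x, y) \<in> M" "x \<noteq> y"
        by (auto simp: K2_def split: if_splits)
      from M_eq[OF *(2)] *(1) have "(u, v) \<in> {(x, y), (y, x)}" by (rule subst)
      then show "(u, v) \<in> M \<and> u \<noteq> v" using * by auto
    qed (auto simp: K2_def)
    ultimately show ?thesis unfolding K_def Union_Un_distrib by blast
  qed
  have no0: "(d, 0) \<notin> M" "(0, d) \<notin> M" using MD(4,5) by blast+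
  have K1_0: "(d, 0) \<in> k \<or> (0, d) \<in> k" "k \<subseteq> {(d, 0), (0, d)}" if "k \<in> K1" for k
    using that by (auto simp: K1_def split: if_splits)
  have finM: "finite M"
    unfolding M_def by (rule finite_subset[OF _ finite_add_decomps[of d]]) auto
  have card_K2: "card K2 = card M - 1"
  proof (cases "M = {}")
    case False
    then obtain u v where uv: "(u, v) \<in> M" by fastforce
    show ?thesis
    proof (cases "u = v")
      case True
      then have "M = {(v, v)}" using M_eq[OF uv] by simp
      then show ?thesis by (auto simp: K2_def)
    next
      case False
      then have "card M = 2" by (subst M_eq[OF uv]) simp
      moreover have "K2 = {M}" using uv False by (auto simp: K2_def)
      ultimately show ?thesis by simp
    qed
  qed (simp add: K2_def)
  have "K1 \<inter> K2 = {}"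
    using K1_0 no0 by (auto simp: K2_def split: if_splits)
  then have "card K = card K1 + card K2"
    unfolding K_def by (intro card_Un_disjoint) (auto simp: K1_def K2_def)
  also have "card K1 = (if d = 0 then 1 else if deg d < m then 2 else of_bool (deg d = m))"
    using m by (auto simp: K1_def)
  finally have card_K: "card K =
      (if d = 0 then 1 else if deg d < m then 2 else of_bool (deg d = m)) + (card M - 1)"
    unfolding card_K2 .
  have disj: "disjoint_family_on id K"
    unfolding disjoint_family_on_def
  proof (intro ballI impI)
    fix k l assume kl: "k \<in> K" "l \<in> K" "k \<noteq> l"
    have 1: "k \<inter> l = {}" if "k \<in> K1" "l \<in> K1" "k \<noteq> l" for k l
      using that by (auto simp: K1_def split: if_splits)
    have 2: "k \<inter> l = {}" if "k \<in> K1" "l \<in> K2" for k l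
      using K1_0(2)[OF that(1)] no0 that(2) by (auto simp: K2_def split: if_splits)
    have 3: "k = l" if "k \<in> K2" "l \<in> K2" for k l
      using that by (auto simp: K2_def split: if_splits)
    show "id k \<inter> id l = {}"
      using kl 1[of k l] 2[of k l] 2[of l k] 3[of k l] unfolding K_def by auto
  qed
  have "mpol.dim (harmonics (G m m) \<inter> (homog_part d :: ('r, 2) polX set)) = card K"
  proof (rule dim_eq_card_pair_classes[where P = id and \<epsilon> = \<epsilon>])
    show "finite K" by (simp add: K_def K1_def K2_def)
    show "finite (id k)" if "k \<in> K" for k
      using that finM by (auto simp: K_def K1_def K2_def split: if_splits)
    show "id k \<noteq> {}" if "k \<in> K" for k
      using that by (auto simp: K_def K1_def K2_def split: if_splits)
    fix g :: "('r, 2) polX"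
    define c where "c u v = dcoeff g (combine u v)" for u v
    have harm: "g \<in> harmonics (G m m) \<longleftrightarrow>
      (\<forall>u v. u \<noteq> 0 \<longrightarrow> v \<noteq> 0 \<longrightarrow> 3 \<le> deg u + deg v \<longrightarrow> c u v = 0) \<and>
      (\<forall>u v. deg u = 1 \<longrightarrow> deg v = 1 \<longrightarrow> c u v + c v u = 0) \<and>
      (\<forall>u. m < deg u \<longrightarrow> c u 0 = 0 \<and> c 0 u = 0) \<and>
      (\<forall>u. deg u = m \<longrightarrow> c u 0 + c 0 u = 0)" (is "_ \<longleftrightarrow> ?mixed \<and> ?one \<and> ?large \<and> ?top")
    proof -
      have pos: "0 < m" using m by simp
      show ?thesis
        unfolding harmonics_rank2_iff[OF pos] diag_invariant_self[OF pos] c_def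
        by (rule dihedral_relations_iff[OF m])
    qed
    have hom: "g \<in> homog_part d \<longleftrightarrow> (\<forall>u v. u + v \<noteq> d \<longrightarrow> c u v = 0)" (is "_ \<longleftrightarrow> ?hom")
      unfolding homog_part_combine_iff c_def ..
    have "(?mixed \<and> ?one \<and> ?large \<and> ?top) \<and> ?hom \<longleftrightarrow>
      (\<forall>u v. (u, v) \<notin> \<Union>K \<longrightarrow> c u v = 0) \<and>
      (\<forall>k\<in>K. \<forall>(u, v)\<in>k. \<forall>(u', v')\<in>k. \<epsilon> u' v' * c u v = \<epsilon> u v * c u' v')"
      (is "_ \<longleftrightarrow> ?out \<and> ?prop")
    proof
      assume *: "(?mixed \<and> ?one \<and> ?large \<and> ?top) \<and> ?hom"
      from * have mixed: ?mixed by (elim conjE)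
      from * have one: ?one by (elim conjE)
      from * have large: ?large by (elim conjE)
      from * have top: ?top by (elim conjE)
      from * have out: ?hom by (elim conjE)
      have ?out
      proof (intro allI impI)
        fix u v assume nK: "(u, v) \<notin> \<Union>K"
        consider "u + v \<noteq> d" | "u + v = d" "u = 0 \<or> v = 0"
          | "u \<noteq> 0" "v \<noteq> 0" "3 \<le> deg u + deg v"
          | "u + v = d" "u \<noteq> 0" "v \<noteq> 0" "\<not> 3 \<le> deg u + deg v" by blast
        then show "c u v = 0"
        proof cases
          case 1
          then show ?thesis using out by blast
        next
          case 2
          then have "m < deg d" using nK unfolding inK by auto
          then have "c d 0 = 0" "c 0 d = 0" using large by blast+
          then show ?thesis using 2 by auto
        next
          case 3
          then show ?thesis using mixed by blast
        next
          \<comment> \<open>Both degrees are one. Lying outside the classes leaves only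
            \<open>u = v\<close>, where antisymmetry gives twice \<open>c u u\<close> equal to
            zero.\<close>
          case 4
          have "deg u \<noteq> 0" "deg v \<noteq> 0" using 4 by auto
          then have "deg u = 1" "deg v = 1" using 4(4) by linarith+
          then have "(u, v) \<in> M" using 4 by (simp add: M_def)
          then have "u = v" using nK unfolding inK by blast
          moreover have "c u v + c v u = 0" using one \<open>deg u = 1\<close> \<open>deg v = 1\<close> by blast
          ultimately show ?thesis by simp
        qed
      qed
      moreover have ?prop
      proof (rule ballI)
        fix k assume kK: "k \<in> K"
        have top': "c d 0 = - c 0 d" if "deg d = m"
          unfolding eq_neg_iff_add_eq_0 using top that by blast
        have one': "c u v = - c v u" if "(u, v) \<in> M" for u v
          unfolding eq_neg_iff_add_eq_0 using one MD(2,3)[OF that] by blast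
        have "case_prod \<epsilon> q * case_prod c p = case_prod \<epsilon> p * case_prod c q"
          if pq: "p \<in> k" "q \<in> k" for p q
        proof (cases "p = q")
          case False
          note k = kK pq
          consider "deg d = m" "k = {(d, 0), (0, d)}" | "k = M"
            using k False by (auto simp: K_def K1_def K2_def split: if_splits)
          then show ?thesis
          proof cases
            case 1
            then show ?thesis using top' \<epsilon>_top k False by auto
          next
            case 2
            obtain u v where p: "p = (u, v)" by fastforce
            then have "q = (v, u)" "u \<noteq> v" using M_eq[of u v] k False 2 by auto
            then show ?thesis using p 2 k one'[of u v] \<epsilon>_M[of u v] by simp
          qed
        qed simp
        then show "\<forall>(u, v)\<in>k. \<forall>(u', v')\<in>k. \<epsilon> u' v' * c u v = \<epsilon> u v * c u' v'"
          by fastforce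
      qed
      ultimately show "?out \<and> ?prop" by blast
    next
      assume "?out \<and> ?prop"
      then have out: "\<And>u v. (u, v) \<notin> \<Union>K \<Longrightarrow> c u v = 0" and prop0: ?prop by blast+
      from prop0 have proportional: "\<epsilon> u' v' * c u v = \<epsilon> u v * c u' v'"
        if "k \<in> K" "(u, v) \<in> k" "(u', v') \<in> k" for k u v u' v'
        using that by fast
      have ?hom
        using MD(1) by (intro allI impI out) (auto simp only: inK)
      moreover have ?mixed
      proof (intro allI impI out)
        fix u v :: "'r \<Rightarrow>\<^sub>0 nat" assume uv: "u \<noteq> 0" "v \<noteq> 0" "3 \<le> deg u + deg v"
        then have "(u, v) \<notin> M" using MD(2,3)[of u v] by auto
        then show "(u, v) \<notin> \<Union>K" using uv unfolding inK by blast
      qed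
      moreover have ?one
      proof (intro allI impI)
        fix u v :: "'r \<Rightarrow>\<^sub>0 nat" assume uv: "deg u = 1" "deg v = 1"
        show "c u v + c v u = 0"
        proof (cases "(u, v) \<in> M \<and> u \<noteq> v")
          case True
          then have "M \<in> K" by (auto simp: K_def K2_def)
          then have "\<epsilon> v u * c u v = \<epsilon> u v * c v u"
            using True MD(7) by (intro proportional) auto
          also have "\<epsilon> u v = - \<epsilon> v u" using True by (intro \<epsilon>_M) auto
          finally have "\<epsilon> v u * (c u v + c v u) = 0" by (simp add: distrib_left)
          then show ?thesis using \<epsilon>_nz by simp
        next
          case False
          moreover have "u \<noteq> 0" "v \<noteq> 0" using uv by auto
          ultimately have "c u v = 0" "c v u = 0"
            using MD(7) by (intro out; unfold inK; blast)+
          then show ?thesis by simp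
        qed
      qed
      moreover have ?large
      proof (intro allI impI conjI out)
        fix u :: "'r \<Rightarrow>\<^sub>0 nat" assume u: "m < deg u"
        have "(u, 0) \<notin> M" "(0, u) \<notin> M" using MD(4,5) by blast+
        then show "(u, 0) \<notin> \<Union>K" "(0, u) \<notin> \<Union>K" using u unfolding inK by auto
      qed
      moreover have ?top
      proof (intro allI impI)
        fix u :: "'r \<Rightarrow>\<^sub>0 nat" assume u: "deg u = m"
        have nM: "(u, 0) \<notin> M" "(0, u) \<notin> M" using MD(4,5) by blast+
        show "c u 0 + c 0 u = 0"
        proof (cases "u = d")
          case True
          then have "{(d, 0), (0, d)} \<in> K" using u by (simp add: K_def K1_def)
          then have "\<epsilon> 0 d * c d 0 = \<epsilon> d 0 * c 0 d" by (rule proportional) simp_all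
          then show ?thesis using True u \<epsilon>_top by (simp add: add_eq_0_iff)
        next
          case False
          then have "c u 0 = 0" "c 0 u = 0" using nM by (intro out; simp only: inK; simp)+
          then show ?thesis by simp
        qed
      qed
      ultimately show "(?mixed \<and> ?one \<and> ?large \<and> ?top) \<and> ?hom" by blast
    qed
    then show "g \<in> harmonics (G m m) \<inter> homog_part d \<longleftrightarrow>
      (\<forall>u v. (u, v) \<notin> (\<Union>k\<in>K. id k) \<longrightarrow> dcoeff g (combine u v) = 0) \<and>
      (\<forall>k\<in>K. \<forall>(u, v)\<in>id k. \<forall>(u', v')\<in>id k.
        \<epsilon> u' v' * dcoeff g (combine u v) = \<epsilon> u v * dcoeff g (combine u' v'))"
      unfolding Int_iff harm hom by (simp add: c_def)
  qed (use disj \<epsilon>_nz in simp_all)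
  then show ?thesis by (simp only: card_K)
qed

subsection \<open>The groups \<open>G(m,1,2)\<close>\<close>

text \<open>Moving \<open>a\<close> and then \<open>b\<close>, both of degree \<open>m\<close>,
  changes the sign twice, while moving \<open>a + b\<close> at once changes it once. Hence
  \<open>c\<close> vanishes on monomials with two such factors, in one column or one in each. All
  relations other than single shifts then involve only such monomials.\<close>

lemma full_monomial_relations_iff:
  fixes c :: "('r::finite \<Rightarrow>\<^sub>0 nat) \<Rightarrow> ('r \<Rightarrow>\<^sub>0 nat) \<Rightarrow> complex"
  assumes m: "0 < m"
  shows "(\<forall>a b u v. (a, b) \<noteq> (0, 0) \<longrightarrow> m dvd deg a \<and> m dvd deg b \<longrightarrow>
      c (a + u) (b + v) + c (b + u) (a + v) = 0) \<longleftrightarrow>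
    (\<forall>u v. 2 * m \<le> deg u \<or> 2 * m \<le> deg v \<or> m \<le> deg u \<and> m \<le> deg v \<longrightarrow> c u v = 0) \<and>
    (\<forall>a u v. deg a = m \<longrightarrow> c (a + u) v + c u (a + v) = 0)"
    (is "?L \<longleftrightarrow> ?zero \<and> ?shift")
proof
  assume L: ?L
  have rel: "c (a + u) v + c u (a + v) = 0" if "m dvd deg a" "deg a \<noteq> 0" for a u v
    using L[rule_format, of a 0 u v] that by auto
  have shift: "c (a + u) v + c u (a + v) = 0" if "deg a = m" for a u v
    using rel[of a u v] that m by simp
  have two: "c (a + b + u) v = 0 \<and> c u (a + b + v) = 0 \<and> c (a + u) (b + v) = 0"
    if ab: "deg a = m" "deg b = m" for a b u v
  proof -
    have "c (a + (b + u)) v + c (b + u) (a + v) = 0" "c (b + u) (a + v) + c u (b + (a + v)) = 0"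
      "c (a + u) (b + v) + c u (a + (b + v)) = 0"
      using shift ab by blast+
    moreover have "deg (a + b) = 2 * m" using ab by (simp add: deg_add)
    then have "c (a + b + u) v + c u (a + b + v) = 0"
      using m by (intro rel) simp_all
    moreover have "a + (b + u) = a + b + u" "b + (a + v) = a + b + v" "a + (b + v) = a + b + v"
      by (simp_all only: ac_simps)
    ultimately have *: "c (a + b + u) v + c (b + u) (a + v) = 0"
      "c (b + u) (a + v) + c u (a + b + v) = 0"
      "c (a + u) (b + v) + c u (a + b + v) = 0" "c (a + b + u) v + c u (a + b + v) = 0"
      by simp_all
    have "2 * c u (a + b + v) = 0"
      using *(1,2,4) by algebra
    then have "c u (a + b + v) = 0" by simp
    with * show ?thesis by simp
  qed
  have split2: "\<exists>a b w. u = a + b + w \<and> deg a = m \<and> deg b = m" if "2 * m \<le> deg u" for u :: "'r \<Rightarrow>\<^sub>0 nat"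
  proof -
    have "m \<le> deg u" using that by linarith
    then obtain a w where aw: "u = a + w" "deg a = m" using deg_split by blast
    then have "m \<le> deg w" using that by (simp add: deg_add)
    then obtain b z where "w = b + z" "deg b = m" using deg_split by blast
    with aw show ?thesis by (metis add.assoc)
  qed
  have "c u v = 0" if "2 * m \<le> deg u \<or> 2 * m \<le> deg v \<or> m \<le> deg u \<and> m \<le> deg v" for u v
    using that
  proof (elim disjE conjE)
    assume "m \<le> deg u" "m \<le> deg v"
    then show ?thesis using deg_split two by metis
  qed (use split2 two in metis)+
  with shift show "?zero \<and> ?shift" by blast
next
  assume "?zero \<and> ?shift"
  then have zero: "2 * m \<le> deg u \<or> 2 * m \<le> deg v \<or> m \<le> deg u \<and> m \<le> deg v \<Longrightarrow> c u v = 0"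
    and shift: "deg a = m \<Longrightarrow> c (a + u) v + c u (a + v) = 0" for a u v
    by blast+
  \<comment> \<open>A multiple of \<open>m\<close> other than \<open>0\<close> and \<open>m\<close>
    is at least \<open>2 * m\<close>, where both terms vanish.\<close>
  have rel0: "c (a + u) v + c u (a + v) = 0" if a: "a \<noteq> 0" "m dvd deg a" for a u v
  proof (cases "deg a = m")
    case False
    obtain k where k: "deg a = m * k" using a(2) by (rule dvdE)
    have "deg a \<noteq> 0" using a(1) by simp
    with k False have "k \<noteq> 0" "k \<noteq> 1" by auto
    then have "m * 2 \<le> m * k" by (intro mult_le_mono) auto
    with k have "2 * m \<le> deg a" by simp
    then have "c (a + u) v = 0" "c u (a + v) = 0"
      by (intro zero; simp only: deg_add; linarith)+
    then show ?thesis by simp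
  qed (rule shift)
  show ?L
  proof (intro allI impI)
    fix a b u v :: "'r \<Rightarrow>\<^sub>0 nat"
    assume ab: "(a, b) \<noteq> (0, 0)" "m dvd deg a \<and> m dvd deg b"
    consider "a = 0" | "b = 0" | "a \<noteq> 0" "b \<noteq> 0" by blast
    then show "c (a + u) (b + v) + c (b + u) (a + v) = 0"
    proof cases
      case 1
      then show ?thesis using ab rel0[of b u v] by (simp add: add.commute)
    next
      case 2
      then show ?thesis using ab rel0[of a u v] by simp
    next
      case 3
      then have "deg a \<noteq> 0" "deg b \<noteq> 0" by simp_all
      then have "m \<le> deg a" "m \<le> deg b" using ab(2) by (auto intro!: dvd_imp_le)
      then have "c (a + u) (b + v) = 0" "c (b + u) (a + v) = 0"
        by (intro zero; simp only: deg_add; linarith)+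
      then show ?thesis by simp
    qed
  qed
qed

text \<open>Induction on the degree, one variable at a time: moving \<open>x + a\<close> to the
  other column and bringing \<open>y + a\<close> back replaces \<open>x\<close> by \<open>y\<close>,
  and the two sign changes cancel.\<close>

lemma shift_imp_exchange:
  fixes c :: "('r::finite \<Rightarrow>\<^sub>0 nat) \<Rightarrow> ('r \<Rightarrow>\<^sub>0 nat) \<Rightarrow> complex"
  assumes shift: "\<And>a u v. deg a = m \<Longrightarrow> c (a + u) v + c u (a + v) = 0" and m: "0 < m"
    and "deg p = deg q" "m \<le> deg (s + p)"
  shows "c (s + p) (t + q) = c (s + q) (t + p)"
  using assms(3,4)
proof (induction "deg p" arbitrary: p q s t)
  case 0
  then show ?case by (metis deg_eq_0_iff)
next
  case (Suc n)
  obtain x p1 where p: "p = x + p1" "deg x = 1" using deg_split[of 1 p] Suc.hyps(2) by auto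
  obtain y q1 where q: "q = y + q1" "deg y = 1" using deg_split[of 1 q] Suc.hyps(2) Suc.prems(1) by auto
  have deg1: "deg p1 = n" "deg q1 = n"
    using Suc.hyps(2) Suc.prems(1) p q by (simp_all only: deg_add)
  \<comment> \<open>The filler \<open>a\<close> of degree \<open>m - 1\<close> will complete both
    \<open>x\<close> and \<open>y\<close> to degree \<open>m\<close>.\<close>
  have "m - 1 \<le> deg (s + p1)"
    using Suc.prems(2) p by (simp only: deg_add)
  then obtain a w where aw: "s + p1 = a + w" "deg a = m - 1" using deg_split by blast
  have "deg (x + a) = m" "deg (y + a) = m" using aw(2) p(2) q(2) m by (simp_all only: deg_add)
  then have "c (x + a + w) (t + q) + c w (x + a + (t + q)) = 0"
    "c (y + a + w) (t + (x + q1)) + c w (y + a + (t + (x + q1))) = 0"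
    using shift by blast+
  moreover have "x + a + (t + q) = y + a + (t + (x + q1))"
    by (simp only: q ac_simps)
  ultimately have "c (x + a + w) (t + q) = c (y + a + w) (t + (x + q1))"
    by (metis add_right_cancel)
  moreover have move: "z + a + w = s + z + p1" for z
  proof -
    have "z + a + w = z + (s + p1)" by (simp only: aw(1) add.assoc)
    then show ?thesis by (simp only: ac_simps)
  qed
  moreover have "s + x + p1 = s + p" by (simp only: p(1) add.assoc)
  moreover have "t + (x + q1) = t + x + q1" by (simp only: add.assoc)
  ultimately have "c (s + p) (t + q) = c (s + y + p1) (t + x + q1)" by simp
  \<comment> \<open>The exchanged variables are absorbed into the fixed parts, and the induction
    hypothesis exchanges \<open>p1\<close> and \<open>q1\<close>.\<close>
  also have "\<dots> = c (s + y + q1) (t + x + p1)"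
    using Suc.hyps(1)[of p1 q1 "s + y" "t + x"] deg1 Suc.prems(2) p q by (simp only: deg_add)
  finally show ?case by (simp only: p q ac_simps)
qed

text \<open>Cancelling common factors reduces this to an exchange: \<open>s\<close> is the gcd of
  \<open>u\<close> and \<open>u'\<close>, \<open>t\<close> that of \<open>v\<close> and
  \<open>v'\<close>, and \<open>u + v = u' + v'\<close> forces the same cofactors \<open>p\<close>
  and \<open>q\<close> on both sides.\<close>

lemma shift_imp_constant:
  fixes c :: "('r::finite \<Rightarrow>\<^sub>0 nat) \<Rightarrow> ('r \<Rightarrow>\<^sub>0 nat) \<Rightarrow> complex"
  assumes shift: "\<And>a u v. deg a = m \<Longrightarrow> c (a + u) v + c u (a + v) = 0" and m: "0 < m"
    and eq: "u + v = u' + v'" "deg u = deg u'" "m \<le> deg u"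
  shows "c u v = c u' v'"
proof -
  define s where "s = Abs_poly_mapping (\<lambda>i. min (lookup u i) (lookup u' i))"
  define t where "t = Abs_poly_mapping (\<lambda>i. min (lookup v i) (lookup v' i))"
  define p where "p = u - s"
  define q where "q = u' - s"
  have lookups: "lookup s i = min (lookup u i) (lookup u' i)"
    "lookup t i = min (lookup v i) (lookup v' i)" for i
    by (simp_all add: s_def t_def)
  have pw: "lookup u i + lookup v i = lookup u' i + lookup v' i" for i
    using arg_cong[OF eq(1), of "\<lambda>a. lookup a i"] by (simp add: lookup_add)
  have u: "u = s + p"
    by (intro poly_mapping_eqI) (simp add: p_def lookup_add lookup_minus lookups)
  have u': "u' = s + q"
    by (intro poly_mapping_eqI) (simp add: q_def lookup_add lookup_minus lookups)
  have v: "v = t + q"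
  proof (rule poly_mapping_eqI)
    show "lookup v i = lookup (t + q) i" for i
      using pw[of i] by (auto simp: q_def lookup_add lookup_minus lookups min_def)
  qed
  have v': "v' = t + p"
  proof (rule poly_mapping_eqI)
    show "lookup v' i = lookup (t + p) i" for i
      using pw[of i] by (auto simp: p_def lookup_add lookup_minus lookups min_def)
  qed
  have "deg p = deg q" "m \<le> deg (s + p)"
    using eq(2,3) arg_cong[OF u, of deg] arg_cong[OF u', of deg] by simp_all
  then have "c (s + p) (t + q) = c (s + q) (t + p)"
    by (intro shift_imp_exchange[of m c] shift m)
  then show ?thesis by (simp only: flip: u u' v v')
qed

text \<open>The first count is of monomials with degree below \<open>m\<close> in both columns,
  which no shift reaches. The second is of bidegrees \<open>(m + k, j)\<close>; each, together with
  \<open>(k, m + j)\<close>, carries a single scalar, however many monomials of multidegree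
  \<open>d\<close> it contains.\<close>

lemma dim_harmonics_full_monomial:
  fixes d :: "'r::finite \<Rightarrow>\<^sub>0 nat"
  assumes m: "0 < m"
  shows "mpol.dim (harmonics (G m 1) \<inter> (homog_part d :: ('r, 2) polX set)) =
    card {(u, v). u + v = d \<and> deg u < m \<and> deg v < m} +
    card {(k, j). k < m \<and> j < m \<and> m + k + j = deg d}"
proof -
  define A where "A = {(u, v). u + v = d \<and> deg u < m \<and> deg v < m}"
  define B where "B = {(k, j). k < m \<and> j < m \<and> m + k + j = deg d}"
  \<comment> \<open>\<open>Inl\<close> labels a single monomial, \<open>Inr\<close> a whole pair of
    bidegrees.\<close>
  define P where "P = case_sum (\<lambda>p. {p})
    (\<lambda>(k, j). {(u, v). u + v = d \<and> (deg u = m + k \<and> deg v = j \<or> deg u = k \<and> deg v = m + j)})"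
  \<comment> \<open>Moving the degree-\<open>m\<close> factor to the other column flips the
    sign.\<close>
  define \<epsilon> :: "('r \<Rightarrow>\<^sub>0 nat) \<Rightarrow> ('r \<Rightarrow>\<^sub>0 nat) \<Rightarrow> complex" where
    "\<epsilon> u v = (if m \<le> deg u then 1 else -1)" for u v
  have finA: "finite A"
    unfolding A_def by (rule finite_subset[OF _ finite_add_decomps[of d]]) auto
  have "B \<subseteq> {..<m} \<times> {..<m}" by (auto simp: B_def)
  then have finB: "finite B" by (rule finite_subset) simp
  have P_Inr: "(u, v) \<in> P (Inr (k, j)) \<longleftrightarrow>
      u + v = d \<and> (deg u = m + k \<and> deg v = j \<or> deg u = k \<and> deg v = m + j)" for u v k j
    by (simp add: P_def)
  have P_Inl: "P (Inl p) = {p}" for p by (simp add: P_def)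
  have inP: "(u, v) \<in> (\<Union>k\<in>A <+> B. P k) \<longleftrightarrow>
      u + v = d \<and> deg u < 2 * m \<and> deg v < 2 * m \<and> \<not> (m \<le> deg u \<and> m \<le> deg v)" (is "?L \<longleftrightarrow> ?R") for u v
  proof
    assume ?L
    then consider "(u, v) \<in> A" | k j where "(k, j) \<in> B" "(u, v) \<in> P (Inr (k, j))"
      by (auto simp: P_Inl)
    then show ?R by cases (auto simp: A_def B_def P_Inr)
  next
    assume R: ?R
    consider "deg u < m" "deg v < m" | "m \<le> deg u" "deg v < m" | "deg u < m" "m \<le> deg v"
      using R by linarith
    then show ?L
    proof cases
      case 1
      then have "(u, v) \<in> A" using R by (simp add: A_def)
      then show ?thesis by (intro UN_I[of "Inl (u, v)"]) (auto simp: P_Inl)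
    next
      case 2
      then have "(deg u - m, deg v) \<in> B" "(u, v) \<in> P (Inr (deg u - m, deg v))"
        using R by (auto simp: B_def P_Inr)
      then show ?thesis by blast
    next
      case 3
      then have "(deg u, deg v - m) \<in> B" "(u, v) \<in> P (Inr (deg u, deg v - m))"
        using R by (auto simp: B_def P_Inr)
      then show ?thesis by blast
    qed
  qed
  have "mpol.dim (harmonics (G m 1) \<inter> (homog_part d :: ('r, 2) polX set)) = card (A <+> B)"
  proof (rule dim_eq_card_pair_classes[where P = P and \<epsilon> = \<epsilon>])
    show "finite (A <+> B)" using finA finB by simp
    show "disjoint_family_on P (A <+> B)"
    proof -
      \<comment> \<open>The label is recovered from any member of the class, so the classes are
        disjoint.\<close>
      have label: "k = (if deg u < m \<and> deg v < m then Inl (u, v)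
          else if m \<le> deg u then Inr (deg u - m, deg v) else Inr (deg u, deg v - m))"
        if "k \<in> A <+> B" "(u, v) \<in> P k" for k u v
        using that(1)
      proof (rule PlusE)
        fix p assume "p \<in> A" "k = Inl p"
        then show ?thesis using that(2) by (auto simp: P_Inl A_def)
      next
        fix q assume "q \<in> B" "k = Inr q"
        then show ?thesis using that(2) by (cases q) (auto simp: P_Inr B_def)
      qed
      have "k = l" if "k \<in> A <+> B" "l \<in> A <+> B" "(u, v) \<in> P k" "(u, v) \<in> P l" for k l u v
        using label[OF that(1,3)] label[OF that(2,4)] by simp
      then show ?thesis
        unfolding disjoint_family_on_def by (metis disjoint_iff surj_pair)
    qed
    show "finite (P k)" if "k \<in> A <+> B" for k
      by (cases k) (auto simp: P_def intro: finite_subset[OF _ finite_add_decomps[of d]])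
    show "P k \<noteq> {}" if k: "k \<in> A <+> B" for k
    proof (cases k)
      case (Inr p)
      then obtain i j where p: "k = Inr (i, j)" "m + i + j = deg d"
        using k by (cases p) (auto simp: Plus_def B_def)
      then have "m + i \<le> deg d" by simp
      then obtain u v where uv: "d = u + v" "deg u = m + i" using deg_split by blast
      then have "deg v = j" using p(2) by simp
      then have "(u, v) \<in> P k" using p(1) uv by (simp add: P_Inr)
      then show ?thesis by blast
    qed (simp add: P_Inl)
    show "\<epsilon> u v \<noteq> 0" for u v by (simp add: \<epsilon>_def)
    fix g :: "('r, 2) polX"
    define c where "c u v = dcoeff g (combine u v)" for u v
    have "g \<in> harmonics (G m 1) \<longleftrightarrow>
      (\<forall>u v. 2 * m \<le> deg u \<or> 2 * m \<le> deg v \<or> m \<le> deg u \<and> m \<le> deg v \<longrightarrow> c u v = 0) \<and>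
      (\<forall>a u v. deg a = m \<longrightarrow> c (a + u) v + c u (a + v) = 0)" (is "_ \<longleftrightarrow> ?zero \<and> ?shift")
      unfolding harmonics_rank2_iff[OF m] diag_invariant_1[OF m] c_def
      by (rule full_monomial_relations_iff[OF m])
    moreover have "g \<in> homog_part d \<longleftrightarrow> (\<forall>u v. u + v \<noteq> d \<longrightarrow> c u v = 0)" (is "_ \<longleftrightarrow> ?hom")
      unfolding homog_part_combine_iff c_def ..
    ultimately have "g \<in> harmonics (G m 1) \<inter> homog_part d \<longleftrightarrow> ?zero \<and> ?shift \<and> ?hom"
      by blast
    also have "\<dots> \<longleftrightarrow> (\<forall>u v. (u, v) \<notin> (\<Union>k\<in>A <+> B. P k) \<longrightarrow> c u v = 0) \<and>
      (\<forall>k\<in>A <+> B. \<forall>(u, v)\<in>P k. \<forall>(u', v')\<in>P k. \<epsilon> u' v' * c u v = \<epsilon> u v * c u' v')"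
      (is "_ \<longleftrightarrow> ?out \<and> ?prop")
    proof
      assume *: "?zero \<and> ?shift \<and> ?hom"
      then have shift: "c (a + u) v + c u (a + v) = 0" if "deg a = m" for a u v
        using that by blast
      have ?out
        unfolding inP using * by (meson not_le)
      moreover have ?prop
      proof (rule ballI)
        fix k assume kK: "k \<in> A <+> B"
        have "case_prod \<epsilon> q * case_prod c p = case_prod \<epsilon> p * case_prod c q"
          if "p \<in> P k" "q \<in> P k" for p q
        proof -
          note k = kK that
          show ?thesis
          proof (cases k)
            case (Inl x)
            then show ?thesis using k by (simp add: P_Inl)
          next
            case (Inr x)
            then obtain i j where x: "k = Inr (i, j)" "(i, j) \<in> B"
              using k by (cases x) (auto simp: Plus_def)
            \<comment> \<open>Each member is normalised to a monomial with degree
              \<open>m + i\<close> in the first column; any two of these have equal \<open>c\<close>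
              by \<open>shift_imp_constant\<close>.\<close>
            have normal: "\<exists>u' v'. u' + v' = d \<and> deg u' = m + i \<and> c u' v' = \<epsilon> u v * c u v"
              if uv: "(u, v) \<in> P k" for u v
            proof (cases "m \<le> deg u")
              case True
              then show ?thesis using uv x by (auto simp: P_Inr B_def \<epsilon>_def)
            next
              case False
              then have deg: "deg u = i" "deg v = m + j" "u + v = d" using uv x by (auto simp: P_Inr)
              then have "m \<le> deg v" by simp
              then obtain a w where aw: "v = a + w" "deg a = m" using deg_split by blast
              have "c (a + u) w = \<epsilon> u v * c u v"
                using shift[OF aw(2), of u w] False aw(1) by (simp add: \<epsilon>_def eq_neg_iff_add_eq_0)
              moreover have "a + u + w = d" using aw(1) deg(3) by (simp add: ac_simps)
              ultimately show ?thesis using aw(2) deg(1) by (intro exI[of _ "a + u"] exI[of _ w]) simp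
            qed
            obtain u v u' v' where pq: "p = (u, v)" "q = (u', v')" by fastforce
            obtain r s where rs: "r + s = d" "deg r = m + i" "c r s = \<epsilon> u v * c u v"
              using normal[of u v] k pq by auto
            obtain r' s' where rs': "r' + s' = d" "deg r' = m + i" "c r' s' = \<epsilon> u' v' * c u' v'"
              using normal[of u' v'] k pq by auto
            have "c r s = c r' s'"
              using rs rs' by (intro shift_imp_constant[of m c] shift m) simp_all
            then have eq: "\<epsilon> u v * c u v = \<epsilon> u' v' * c u' v'" using rs rs' by simp
            have "\<epsilon> u' v' * c u v = \<epsilon> u v * \<epsilon> u' v' * (\<epsilon> u v * c u v)" by (simp add: \<epsilon>_def)
            also have "\<dots> = \<epsilon> u v * c u' v'" unfolding eq by (simp add: \<epsilon>_def)
            finally show ?thesis by (simp add: pq)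
          qed
        qed
        then show "\<forall>(u, v)\<in>P k. \<forall>(u', v')\<in>P k. \<epsilon> u' v' * c u v = \<epsilon> u v * c u' v'"
          by fastforce
      qed
      ultimately show "?out \<and> ?prop" by blast
    next
      assume *: "?out \<and> ?prop"
      then have out: "c u v = 0" if "(u, v) \<notin> (\<Union>k\<in>A <+> B. P k)" for u v
        using that by blast
      have ?zero
        by (intro allI impI out) (auto simp only: inP not_le)
      moreover have ?hom
        by (intro allI impI out) (simp only: inP simp_thms)
      moreover have ?shift
      proof (intro allI impI)
        fix a u v :: "'r \<Rightarrow>\<^sub>0 nat" assume a: "deg a = m"
        show "c (a + u) v + c u (a + v) = 0"
        proof (cases "a + u + v = d \<and> deg u < m \<and> deg v < m")
          case True
          then have deg: "deg d = m + deg u + deg v" using a by auto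
          have B: "(deg u, deg v) \<in> B" using True deg by (simp add: B_def)
          have "(a + u, v) \<in> P (Inr (deg u, deg v))" "(u, a + v) \<in> P (Inr (deg u, deg v))"
            using True a by (auto simp: P_Inr ac_simps)
          then have "\<epsilon> u (a + v) * c (a + u) v = \<epsilon> (a + u) v * c u (a + v)"
            using * B by blast
          then show ?thesis using True a by (simp add: \<epsilon>_def add_eq_0_iff)
        next
          \<comment> \<open>Either the multidegree is wrong, or a column has degree at least
            \<open>m\<close> without \<open>a\<close>; adding \<open>a\<close> then makes one column
            reach \<open>2 * m\<close> or both reach \<open>m\<close>.\<close>
          case False
          have "c (a + u) v = 0"
            using False a by (intro out) (simp only: inP, auto)
          moreover have "c u (a + v) = 0"
            using False a by (intro out) (simp only: inP, auto simp: ac_simps)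
          ultimately show ?thesis by simp
        qed
      qed
      ultimately show "?zero \<and> ?shift \<and> ?hom" by blast
    qed
    finally show "g \<in> harmonics (G m 1) \<inter> homog_part d \<longleftrightarrow>
      (\<forall>u v. (u, v) \<notin> (\<Union>k\<in>A <+> B. P k) \<longrightarrow> dcoeff g (combine u v) = 0) \<and>
      (\<forall>k\<in>A <+> B. \<forall>(u, v)\<in>P k. \<forall>(u', v')\<in>P k.
        \<epsilon> u' v' * dcoeff g (combine u v) = \<epsilon> u v * dcoeff g (combine u' v'))"
      by (simp only: c_def)
  qed
  then show ?thesis using finA finB by (simp add: card_Plus flip: A_def B_def)
qed

subsection \<open>Coefficients of the claimed series\<close>

lemma lookup_of_nat_times: "lookup (of_nat n * p :: ('v, 'c::comm_semiring_1) mpol) d = of_nat n * lookup p d"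
  using lookup_pscale[of "of_nat n" p d] by (simp add: pscale_def pconst_def)

lemma lookup_two_times: "lookup (2 * p :: ('v, int) mpol) d = 2 * lookup p d"
  using lookup_of_nat_times[of 2 p d] by simp

lemma sum_of_bool_eq_member: "finite A \<Longrightarrow> (\<Sum>j\<in>A. of_bool (x = j) :: int) = of_bool (x \<in> A)"
  by (induction A rule: finite_induct) auto

text \<open>With \<open>n\<close> factorizations of \<open>d\<close> into two variables, the square
  of \<open>h 1\<close> plus \<open>h 2\<close> gives \<open>n + 1 = 2 + (n - 1)\<close> in degree
  two. If \<open>m = 2\<close>, the reversed sum subtracts two and \<open>h m\<close> adds one,
  leaving \<open>n = 1 + (n - 1)\<close>.\<close>

lemma lookup_dihedral_series:
  fixes d :: "'r::finite \<Rightarrow>\<^sub>0 nat"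
  assumes "2 \<le> m"
  shows "lookup (1 + 2 * h 1 + (h 1)\<^sup>2 + h 2 + 2 * sum_from_to 3 (m - 1) h + h m :: ('r, int) mpol) d =
    int ((if d = 0 then 1 else if deg d < m then 2 else of_bool (deg d = m)) +
      (card {(u, v). u + v = d \<and> deg u = 1 \<and> deg v = 1} - 1))"
proof -
  let ?M = "{(u, v). u + v = d \<and> deg u = 1 \<and> deg v = 1}"
  have sq: "lookup ((h 1)\<^sup>2) d = int (card ?M)"
    unfolding power2_eq_square by (rule lookup_h_times_h)
  have tail: "lookup (sum_from_to 3 (m - 1) h) d =
      (if m = 2 then - of_bool (deg d = 2) else of_bool (3 \<le> deg d \<and> deg d < m) :: int)"
  proof -
    \<comment> \<open>For \<open>m = 2\<close> the reversed range is \<open>{2}\<close>, counted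
      negatively; for \<open>m = 3\<close> it is empty.\<close>
    have "{m - 1 + 1..<3} = (if m = 2 then {2} else {})" using assms by auto
    then show ?thesis
      using assms unfolding sum_from_to_def
      by (auto simp: lookup_sum lookup_h_deg sum_of_bool_eq_member)
  qed
  have one: "lookup (1 :: ('r, int) mpol) d = of_bool (deg d = 0)"
    by (simp add: lookup_one when_def)
  have M0: "card ?M = 0" if "deg d \<noteq> 2"
  proof -
    have "?M = {}" using that by auto
    then show ?thesis by (simp only: card.empty)
  qed
  have M2: "1 \<le> card ?M" if "deg d = 2"
  proof -
    have "1 \<le> deg d" using that by simp
    then obtain u v where uv: "d = u + v" "deg u = 1" using deg_split by blast
    then have "(u, v) \<in> ?M" using that by auto
    moreover have "finite ?M"
      by (rule finite_subset[OF _ finite_add_decomps[of d]]) auto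
    ultimately show ?thesis by (simp only: card_0_eq less_one flip: not_less) blast
  qed
  \<comment> \<open>A numerical identity in \<open>k = deg d\<close> and \<open>n = card ?M\<close>;
    \<open>1 \<le> n\<close> in degree two makes the natural subtraction exact.\<close>
  have key: "of_bool (k = 0) + 2 * of_bool (k = 1) + int n + of_bool (k = 2) +
      2 * (if m = 2 then - of_bool (k = 2) else of_bool (3 \<le> k \<and> k < m)) + of_bool (k = m) =
      int ((if k = 0 then 1 else if k < m then 2 else of_bool (k = m)) + (n - 1))"
    if "k \<noteq> 2 \<Longrightarrow> n = 0" "k = 2 \<Longrightarrow> 1 \<le> n" for k n
  proof (cases "k = 2")
    case True
    then have "1 \<le> n" by (rule that(2))
    then obtain n' where "n = Suc n'" by (cases n) auto
    then show ?thesis using True assms by auto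
  next
    case False
    then have "n = 0" by (rule that(1))
    then show ?thesis using False assms by (auto simp: of_bool_def)
  qed
  have d0: "d = 0 \<longleftrightarrow> deg d = 0" by simp
  show ?thesis
    unfolding lookup_add lookup_two_times lookup_h_deg sq tail one d0
    using M0 M2 by (rule key)
qed

text \<open>\<open>k\<close> determines \<open>j\<close> and starts at \<open>s + 1 - m\<close>,
  which truncates to \<open>0\<close> for \<open>s < m\<close>. The right-hand side truncates to
  \<open>0\<close> once the antidiagonal has left the square.\<close>

lemma card_square_antidiagonal:
  "card {(k, j). k < m \<and> j < m \<and> k + j = s} = (if s < m then s + 1 else 2 * m - 1 - s)"
proof -
  have "{(k, j). k < m \<and> j < m \<and> k + j = s} = (\<lambda>k. (k, s - k)) ` {s + 1 - m..<min m (s + 1)}"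
    by (auto simp: image_iff)
  then have "card {(k, j). k < m \<and> j < m \<and> k + j = s} = card {s + 1 - m..<min m (s + 1)}"
    by (simp add: card_image inj_on_def)
  then show ?thesis by auto
qed

text \<open>The square expands into factorizations with both degrees below \<open>m\<close>. The two
  linear sums are the rising and falling halves of the antidiagonal counts in an \<open>m\<close> by
  \<open>m\<close> square: \<open>k + 1\<close> in degree \<open>m + k\<close> and
  \<open>m - k\<close> in degree \<open>2 * m - 1 + k\<close>.\<close>

lemma lookup_full_monomial_series:
  fixes d :: "'r::finite \<Rightarrow>\<^sub>0 nat"
  assumes "0 < m"
  shows "lookup ((\<Sum>k=0..m-1. h k)\<^sup>2 + (\<Sum>k=0..m-1. of_nat (k + 1) * h (m + k))
      + (\<Sum>k=1..m-1. of_nat (m - k) * h (2 * m - 1 + k)) :: ('r, int) mpol) d =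
    int (card {(u, v). u + v = d \<and> deg u < m \<and> deg v < m} +
      card {(k, j). k < m \<and> j < m \<and> m + k + j = deg d})"
proof -
  have "lookup ((\<Sum>k=0..m-1. h k)\<^sup>2) d =
      (\<Sum>k=0..m-1. \<Sum>l=0..m-1. int (card {(u, v). u + v = d \<and> deg u = k \<and> deg v = l}))"
    by (simp add: power2_eq_square sum_product lookup_sum lookup_h_times_h)
  also have "\<dots> = (\<Sum>(k, l)\<in>{0..m-1} \<times> {0..m-1}. int (card {(u, v). u + v = d \<and> deg u = k \<and> deg v = l}))"
    by (rule sum.cartesian_product)
  also have "\<dots> = int (\<Sum>q\<in>{0..m-1} \<times> {0..m-1}. card {(u, v). u + v = d \<and> deg u = fst q \<and> deg v = snd q})"
    by (simp add: case_prod_beta)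
  also have "(\<Sum>q\<in>{0..m-1} \<times> {0..m-1}. card {(u, v). u + v = d \<and> deg u = fst q \<and> deg v = snd q}) =
      card (\<Union>q\<in>{0..m-1} \<times> {0..m-1}. {(u, v). u + v = d \<and> deg u = fst q \<and> deg v = snd q})"
  proof (rule card_UN_disjoint[symmetric])
    show "\<forall>q\<in>{0..m-1} \<times> {0..m-1}. finite {(u, v). u + v = d \<and> deg u = fst q \<and> deg v = snd q}"
      by (intro ballI finite_subset[OF _ finite_add_decomps[of d]]) auto
  qed auto
  also have "(\<Union>q\<in>{0..m-1} \<times> {0..m-1}. {(u, v). u + v = d \<and> deg u = fst q \<and> deg v = snd q}) =
      {(u, v). u + v = d \<and> deg u < m \<and> deg v < m}"
    using assms by auto
  finally have sq: "lookup ((\<Sum>k=0..m-1. h k)\<^sup>2) d =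
      int (card {(u, v). u + v = d \<and> deg u < m \<and> deg v < m})" .
  have low: "lookup (\<Sum>k=0..m-1. of_nat (k + 1) * h (m + k)) d =
      (if m \<le> deg d \<and> deg d < 2 * m then int (deg d - m + 1) else 0)"
  proof -
    \<comment> \<open>Truncated subtraction sends degrees below \<open>m\<close> to the index
      \<open>0\<close>; the inner test discards them.\<close>
    have "lookup (\<Sum>k=0..m-1. of_nat (k + 1) * h (m + k)) d =
        (\<Sum>k=0..m-1. if k = deg d - m then (if m \<le> deg d then int (deg d - m + 1) else 0) else 0)"
      unfolding lookup_sum lookup_of_nat_times lookup_h_deg by (rule sum.cong) auto
    then show ?thesis using assms by auto
  qed
  have high: "lookup (\<Sum>k=1..m-1. of_nat (m - k) * h (2 * m - 1 + k)) d =
      (if 2 * m \<le> deg d \<and> deg d < 3 * m then int (3 * m - 1 - deg d) else 0)"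
  proof -
    \<comment> \<open>The range starts at \<open>1\<close>, so degrees below \<open>2 * m\<close>,
      where the subtraction gives \<open>0\<close>, match no index.\<close>
    have "lookup (\<Sum>k=1..m-1. of_nat (m - k) * h (2 * m - 1 + k)) d =
        (\<Sum>k=1..m-1. if k = deg d + 1 - 2 * m then int (3 * m - 1 - deg d) else 0)"
      unfolding lookup_sum lookup_of_nat_times lookup_h_deg by (rule sum.cong) auto
    then show ?thesis using assms by auto
  qed
  have "card {(k, j). k < m \<and> j < m \<and> m + k + j = deg d} =
      (if m \<le> deg d then card {(k, j). k < m \<and> j < m \<and> k + j = deg d - m} else 0)"
  proof (cases "m \<le> deg d")
    case True
    then have "{(k, j). k < m \<and> j < m \<and> m + k + j = deg d} = {(k, j). k < m \<and> j < m \<and> k + j = deg d - m}"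
      by auto
    then show ?thesis using True by simp
  next
    case False
    then have "{(k, j). k < m \<and> j < m \<and> m + k + j = deg d} = {}" by auto
    then show ?thesis using False by simp
  qed
  then show ?thesis
    unfolding lookup_add sq low high card_square_antidiagonal by auto
qed

text \<open>Power series are coefficient functions, so each equality is checked in a fixed
  multidegree \<open>d\<close>, where the class count meets the coefficient.\<close>

theorem theorem3:
  fixes m :: nat
  assumes "m \<ge> 2"
  shows "hilbert_series (G m 1 :: (complex ^ 1 ^ 1) set) =
           Poly_Mapping.lookup (\<Sum>j=0..m-1. h j :: ('r::finite, int) mpol)
       \<and> hilbert_series (G m m :: (complex ^ 2 ^ 2) set) =
           Poly_Mapping.lookup
             (1 + 2 * h 1 + (h 1)\<^sup>2 + h 2 + 2 * sum_from_to 3 (m - 1) h + h m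
                :: ('r, int) mpol)
       \<and> hilbert_series (G m 1 :: (complex ^ 2 ^ 2) set) =
           Poly_Mapping.lookup
             ((\<Sum>k=0..m-1. h k)\<^sup>2 + (\<Sum>k=0..m-1. of_nat (k + 1) * h (m + k))
                + (\<Sum>k=1..m-1. of_nat (m - k) * h (2 * m - 1 + k))
                :: ('r, int) mpol)"
proof (intro conjI ext)
  fix d :: "'r \<Rightarrow>\<^sub>0 nat"
  have pos: "0 < m" using assms by simp
  have "lookup (\<Sum>j=0..m-1. h j) d = (of_bool (deg d < m) :: int)"
    using pos by (auto simp: lookup_sum lookup_h_deg sum_of_bool_eq_member)
  then show "hilbert_series (G m 1 :: (complex ^ 1 ^ 1) set) d = lookup (\<Sum>j=0..m-1. h j) d"
    unfolding hilbert_series_def dim_harmonics_rank1[OF pos] by simp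
  show "hilbert_series (G m m :: (complex ^ 2 ^ 2) set) d =
      lookup (1 + 2 * h 1 + (h 1)\<^sup>2 + h 2 + 2 * sum_from_to 3 (m - 1) h + h m) d"
    unfolding hilbert_series_def lookup_dihedral_series[OF assms] dim_harmonics_dihedral[OF assms] ..
  show "hilbert_series (G m 1 :: (complex ^ 2 ^ 2) set) d =
      lookup ((\<Sum>k=0..m-1. h k)\<^sup>2 + (\<Sum>k=0..m-1. of_nat (k + 1) * h (m + k))
        + (\<Sum>k=1..m-1. of_nat (m - k) * h (2 * m - 1 + k))) d"
    unfolding hilbert_series_def lookup_full_monomial_series[OF pos]
      dim_harmonics_full_monomial[OF pos] ..
qed

end
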